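(* Let $n\ge 1$ and let $a_1,a_2,a_3,b>0$. Assume that the $\mathrm{Sp}(n+1)$-invariant metric $T=g_{(a_1,a_2,a_3,b)}$ on $\mathbb S^{4n+3}$ satisfies $$\frac{b}{a_i}<2n+4,\qquad i=1,2,3.$$ Then there exists an $\mathrm{Sp}(n+1)$-invariant Riemannian metric $g$ on $\mathbb S^{4n+3}$ such that $\operatorname{Ric} g=cT$ for some constant $c>0$.
   Context: $\mathbb S^{4n+3}=\mathrm{Sp}(n+1)/\mathrm{Sp}(n)$ is the unit sphere in $\mathbb H^{n+1}$, and $\hat g$ is its round metric of curvature 1. Consider the Hopf fibration $\mathbb S^3\hookrightarrow\mathbb S^{4n+3}\to\mathbb{HP}^n$. At the base point, the tangent space is identified with the $\mathrm{Ad}(\mathrm{Sp}(n))$-invariant complement of $\mathfrak{sp}(n)$ in $\mathfrak{sp}(n+1)$ and splits $\hat g$-orthogonally as $V\oplus H$, where $V\cong\mathfrak{sp}(1)$ (the copy commuting with $\mathfrak{sp}(n)$) is the 3-dimensional vertical space tangent to the fiber and $H\cong\mathbb H^n$ is the horizontal space. Let $\{e_1,e_2,e_3\}$ be a $\hat g$-orthonormal basis of $V$ with $[e_i,e_{i+1}]=2e_{i+2}$ (indices mod 3). For $x_1,x_2,x_3,s>0$, $g_{(x_1,x_2,x_3,s)}$ denotes the $\mathrm{Sp}(n+1)$-invariant metric given at the base point by $$g(e_i,e_j)=x_i\delta_{ij},\qquad g|_H=s\,\hat g|_H,\qquad g(e_i,H)=0.$$ Up to isometry, every $\mathrm{Sp}(n+1)$-invariant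 metric on $\mathbb S^{4n+3}$ is of this form. $\operatorname{Ric} g$ is the Ricci $(0,2)$-tensor of $g$. *)

theory Defs
  imports "HOL-Analysis.Analysis"
begin

section \<open>Quaternions\<close>

codatatype quat = Quat (qRe: real) (qI: real) (qJ: real) (qK: real)

lemma quat_eqI [intro?]:
  "qRe x = qRe y \<Longrightarrow> qI x = qI y \<Longrightarrow> qJ x = qJ y \<Longrightarrow> qK x = qK y \<Longrightarrow> x = y"
  by (rule quat.expand) simp

lemma quat_eq_iff:
  "x = y \<longleftrightarrow> qRe x = qRe y \<and> qI x = qI y \<and> qJ x = qJ y \<and> qK x = qK y"
  by (auto intro: quat.expand)

instantiation quat :: ab_group_add
begin

primcorec zero_quat where
  "qRe 0 = 0" | "qI 0 = 0" | "qJ 0 = 0" | "qK 0 = 0"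

primcorec plus_quat where
  "qRe (x + y) = qRe x + qRe y" | "qI (x + y) = qI x + qI y"
| "qJ (x + y) = qJ x + qJ y" | "qK (x + y) = qK x + qK y"

primcorec uminus_quat where
  "qRe (- x) = - qRe x" | "qI (- x) = - qI x" | "qJ (- x) = - qJ x" | "qK (- x) = - qK x"

primcorec minus_quat where
  "qRe (x - y) = qRe x - qRe y" | "qI (x - y) = qI x - qI y"
| "qJ (x - y) = qJ x - qJ y" | "qK (x - y) = qK x - qK y"

instance
  by standard (simp_all add: quat_eq_iff)

end

instantiation quat :: real_algebra_1
begin

primcorec one_quat where
  "qRe 1 = 1" | "qI 1 = 0" | "qJ 1 = 0" | "qK 1 = 0"

primcorec times_quat where
  "qRe (x * y) = qRe x * qRe y - qI x * qI y - qJ x * qJ y - qK x * qK y"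
| "qI (x * y) = qRe x * qI y + qI x * qRe y + qJ x * qK y - qK x * qJ y"
| "qJ (x * y) = qRe x * qJ y - qI x * qK y + qJ x * qRe y + qK x * qI y"
| "qK (x * y) = qRe x * qK y + qI x * qJ y - qJ x * qI y + qK x * qRe y"

primcorec scaleR_quat where
  "qRe (scaleR r x) = r * qRe x" | "qI (scaleR r x) = r * qI x"
| "qJ (scaleR r x) = r * qJ x" | "qK (scaleR r x) = r * qK x"

instance
  by standard (simp_all add: quat_eq_iff algebra_simps)

end

instantiation quat :: real_inner
begin

definition inner_quat :: "quat \<Rightarrow> quat \<Rightarrow> real" where
  "inner x y = qRe x * qRe y + qI x * qI y + qJ x * qJ y + qK x * qK y"

definition norm_quat :: "quat \<Rightarrow> real" where
  "norm (x :: quat) = sqrt (inner x x)"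

definition sgn_quat :: "quat \<Rightarrow> quat" where
  "sgn (x :: quat) = x /\<^sub>R norm x"

definition dist_quat :: "quat \<Rightarrow> quat \<Rightarrow> real" where
  "dist (x :: quat) y = norm (x - y)"

definition uniformity_quat [code del]:
  "(uniformity :: (quat \<times> quat) filter) = (INF e\<in>{0 <..}. principal {(x, y). dist x y < e})"

definition open_quat [code del]:
  "open (U :: quat set) \<longleftrightarrow> (\<forall>x\<in>U. eventually (\<lambda>(x', y). x' = x \<longrightarrow> y \<in> U) uniformity)"

instance
proof
  fix x y z :: quat and r :: real
  show "inner x y = inner y x"
    by (simp add: inner_quat_def mult.commute)
  show "inner (x + y) z = inner x z + inner y z"
    by (simp add: inner_quat_def algebra_simps)
  show "inner (scaleR r x) y = r * inner x y"
    by (simp add: inner_quat_def algebra_simps)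
  show "0 \<le> inner x x"
    by (simp add: inner_quat_def)
  show "inner x x = 0 \<longleftrightarrow> x = 0"
    by (simp add: inner_quat_def quat_eq_iff add_nonneg_eq_0_iff conj_assoc)
qed (simp_all add: norm_quat_def sgn_quat_def dist_quat_def uniformity_quat open_quat)

end

primcorec quat_i :: quat where
  "qRe quat_i = 0" | "qI quat_i = 1" | "qJ quat_i = 0" | "qK quat_i = 0"

primcorec quat_j :: quat where
  "qRe quat_j = 0" | "qI quat_j = 0" | "qJ quat_j = 1" | "qK quat_j = 0"

primcorec quat_k :: quat where
  "qRe quat_k = 0" | "qI quat_k = 0" | "qJ quat_k = 0" | "qK quat_k = 1"

instantiation quat :: euclidean_space
begin

definition Basis_quat :: "quat set" where
  "Basis = {1, quat_i, quat_j, quat_k}"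

instance
proof
  show "(Basis :: quat set) \<noteq> {}" "finite (Basis :: quat set)"
    by (simp_all add: Basis_quat_def)
next
  fix u v :: quat
  assume "u \<in> Basis" "v \<in> Basis"
  then show "inner u v = (if u = v then 1 else 0)"
    unfolding Basis_quat_def by (elim insertE emptyE; simp add: inner_quat_def quat_eq_iff)
next
  fix x :: quat
  show "(\<forall>u\<in>Basis. inner x u = 0) \<longleftrightarrow> x = 0"
    unfolding Basis_quat_def by (simp add: inner_quat_def) (simp add: quat_eq_iff)
qed

end

instance quat :: real_normed_algebra_1
proof
  fix x y :: quat
  have "inner (x * y) (x * y) = inner x x * inner y y"
    by (simp add: inner_quat_def algebra_simps)
  then show "norm (x * y) \<le> norm x * norm y"
    by (simp add: norm_quat_def real_sqrt_mult)
  show "norm (1 :: quat) = 1"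
    by (simp add: norm_quat_def inner_quat_def)
qed

primcorec qcnj :: "quat \<Rightarrow> quat" where
  "qRe (qcnj x) = qRe x" | "qI (qcnj x) = - qI x"
| "qJ (qcnj x) = - qJ x" | "qK (qcnj x) = - qK x"


section \<open>Riemannian geometry of the unit sphere of a Euclidean space\<close>

text \<open>
  Functions, vector fields and tensors on the unit sphere are total functions on the ambient space
  of which only the values on \<^term>\<open>sphere 0 1\<close> matter: \<^term>\<open>g p u v\<close> is the value at the
  point \<^term>\<open>p\<close> of the (0,2)-tensor \<^term>\<open>g\<close> on tangent vectors \<^term>\<open>u\<close>, \<^term>\<open>v\<close>.
\<close>

type_synonym 'a tensor2 = "'a \<Rightarrow> 'a \<Rightarrow> 'a \<Rightarrow> real"
type_synonym 'a connection = "('a \<Rightarrow> 'a) \<Rightarrow> ('a \<Rightarrow> 'a) \<Rightarrow> ('a \<Rightarrow> 'a)"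

primrec Ck_on :: "nat \<Rightarrow> 'a::euclidean_space set \<Rightarrow> ('a \<Rightarrow> 'b::real_normed_vector) \<Rightarrow> bool" where
  "Ck_on 0 U f \<longleftrightarrow> continuous_on U f"
| "Ck_on (Suc k) U f \<longleftrightarrow>
     (\<forall>x\<in>U. f differentiable (at x)) \<and> (\<forall>v. Ck_on k U (\<lambda>x. frechet_derivative f (at x) v))"

definition smooth_on :: "'a::euclidean_space set \<Rightarrow> ('a \<Rightarrow> 'b::real_normed_vector) \<Rightarrow> bool" where
  "smooth_on U f \<longleftrightarrow> (\<forall>k. Ck_on k U f)"

text \<open>
  \<^term>\<open>sgn x\<close> is \<^term>\<open>x /\<^sub>R norm x\<close>, the radial retraction of the punctured space onto the
  sphere. A function on the sphere is smooth iff its pullback by this smooth retraction is, and the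
  differential of that pullback at a point of the sphere restricts on tangent vectors to the
  intrinsic differential.
\<close>

definition smooth_on_sphere :: "('a::euclidean_space \<Rightarrow> 'b::real_normed_vector) \<Rightarrow> bool" where
  "smooth_on_sphere f \<longleftrightarrow> smooth_on (- {0}) (\<lambda>x. f (sgn x))"

definition sphere_deriv :: "('a::euclidean_space \<Rightarrow> 'b::real_normed_vector) \<Rightarrow> 'a \<Rightarrow> 'a \<Rightarrow> 'b" where
  "sphere_deriv f p v = frechet_derivative (\<lambda>x. f (sgn x)) (at p) v"

definition sphere_tangent :: "'a::euclidean_space \<Rightarrow> 'a set" where
  "sphere_tangent p = {v. inner p v = 0}"

definition vector_field :: "('a::euclidean_space \<Rightarrow> 'a) \<Rightarrow> bool" where
  "vector_field X \<longleftrightarrow> smooth_on_sphere X \<and> (\<forall>p\<in>sphere 0 1. X p \<in> sphere_tangent p)"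

definition vf_bracket :: "('a::euclidean_space \<Rightarrow> 'a) \<Rightarrow> ('a \<Rightarrow> 'a) \<Rightarrow> 'a \<Rightarrow> 'a" where
  "vf_bracket X Y p = sphere_deriv Y p (X p) - sphere_deriv X p (Y p)"

definition riemannian_metric :: "'a::euclidean_space tensor2 \<Rightarrow> bool" where
  "riemannian_metric g \<longleftrightarrow>
     (\<forall>p\<in>sphere 0 1. \<forall>u\<in>sphere_tangent p. \<forall>v\<in>sphere_tangent p. \<forall>w\<in>sphere_tangent p. \<forall>r.
        g p (u + v) w = g p u w + g p v w \<and> g p (r *\<^sub>R u) v = r * g p u v \<and>
        g p u v = g p v u \<and> (u \<noteq> 0 \<longrightarrow> g p u u > 0)) \<and>
     (\<forall>X Y. vector_field X \<longrightarrow> vector_field Y \<longrightarrow> smooth_on_sphere (\<lambda>p. g p (X p) (Y p)))"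

definition affine_connection :: "'a::euclidean_space connection \<Rightarrow> bool" where
  "affine_connection D \<longleftrightarrow>
     (\<forall>X Y. vector_field X \<longrightarrow> vector_field Y \<longrightarrow> vector_field (D X Y)) \<and>
     (\<forall>X Y Z f. vector_field X \<longrightarrow> vector_field Y \<longrightarrow> vector_field Z \<longrightarrow>
        smooth_on_sphere (f :: 'a \<Rightarrow> real) \<longrightarrow>
        (\<forall>p\<in>sphere 0 1.
           D (\<lambda>q. X q + Y q) Z p = D X Z p + D Y Z p \<and>
           D (\<lambda>q. f q *\<^sub>R X q) Z p = f p *\<^sub>R D X Z p \<and>
           D X (\<lambda>q. Y q + Z q) p = D X Y p + D X Z p \<and>
           D X (\<lambda>q. f q *\<^sub>R Y q) p = sphere_deriv f p (X p) *\<^sub>R Y p + f p *\<^sub>R D X Y p))"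

definition is_levi_civita :: "'a::euclidean_space tensor2 \<Rightarrow> 'a connection \<Rightarrow> bool" where
  "is_levi_civita g D \<longleftrightarrow> affine_connection D \<and>
     (\<forall>X Y Z. vector_field X \<longrightarrow> vector_field Y \<longrightarrow> vector_field Z \<longrightarrow>
        (\<forall>p\<in>sphere 0 1.
           D X Y p - D Y X p = vf_bracket X Y p \<and>
           sphere_deriv (\<lambda>q. g q (Y q) (Z q)) p (X p) = g p (D X Y p) (Z p) + g p (Y p) (D X Z p)))"

text \<open>The choice is unique up to values on non-smooth arguments and off the sphere.\<close>

definition levi_civita :: "'a::euclidean_space tensor2 \<Rightarrow> 'a connection" where
  "levi_civita g = (SOME D. is_levi_civita g D)"

definition curvature ::
  "'a::euclidean_space tensor2 \<Rightarrow> ('a \<Rightarrow> 'a) \<Rightarrow> ('a \<Rightarrow> 'a) \<Rightarrow> ('a \<Rightarrow> 'a) \<Rightarrow> 'a \<Rightarrow> 'a" where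
  "curvature g X Y Z p =
     (let D = levi_civita g in D X (D Y Z) p - D Y (D X Z) p - D (vf_bracket X Y) Z p)"

text \<open>
  A vector field whose value at any \<^term>\<open>p\<close> in the sphere to which \<^term>\<open>v\<close> is tangent is
  \<^term>\<open>v\<close>. As the curvature is tensorial, it may be evaluated on tangent vectors through any
  such extension.
\<close>

definition tangent_ext :: "'a::euclidean_space \<Rightarrow> 'a \<Rightarrow> 'a" where
  "tangent_ext v q = v - inner q v *\<^sub>R q"

definition trace_on :: "'a::euclidean_space set \<Rightarrow> ('a \<Rightarrow> 'a) \<Rightarrow> real" where
  "trace_on V L = (let B = (SOME B. independent B \<and> span B = V)
     in \<Sum>b\<in>B. representation B (L b) b)"

definition ricci :: "'a::euclidean_space tensor2 \<Rightarrow> 'a tensor2" where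
  "ricci g p u v = trace_on (sphere_tangent p)
     (\<lambda>w. curvature g (tangent_ext w) (tangent_ext u) (tangent_ext v) p)"


section \<open>The action of the quaternionic unitary group\<close>

text \<open>
  For a finite type \<^typ>\<open>'n\<close> of cardinality n (hence n at least 1), the space of (n+1)-tuples of quaternions is
  \<^typ>\<open>quat ^ ('n::finite) option\<close>, regarded as a right quaternionic vector space; matrices act
  from the left by \<^const>\<open>matrix_vector_mult\<close>. The base point is the last standard unit
  vector, at the index \<^term>\<open>None\<close>.
\<close>

type_synonym 'n hvec = "quat ^ 'n option"
type_synonym 'n hmat = "quat ^ 'n option ^ 'n option"

definition hadjoint :: "('n::finite) hmat \<Rightarrow> 'n hmat" where
  "hadjoint A = (\<chi> i j. qcnj (A $ j $ i))"

definition Sp_group :: "('n::finite) hmat set" where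
  "Sp_group = {A. hadjoint A ** A = mat 1}"

definition sp_algebra :: "('n::finite) hmat set" where
  "sp_algebra = {A. hadjoint A + A = 0}"

definition mat_bracket :: "('n::finite) hmat \<Rightarrow> 'n hmat \<Rightarrow> 'n hmat" where
  "mat_bracket A B = A ** B - B ** A"

definition base_point :: "('n::finite) hvec" where
  "base_point = axis None 1"

text \<open>The Lie algebra of the stabilizer Sp(n) of the base point.\<close>

definition isotropy_algebra :: "('n::finite) hmat set" where
  "isotropy_algebra = {A \<in> sp_algebra. A *v base_point = 0}"

text \<open>
  A Lie algebra element \<^term>\<open>A\<close> is identified with the tangent vector
  \<^term>\<open>A *v base_point\<close>, its action field at the base point.
\<close>

definition vertical_algebra :: "('n::finite) hmat set" where
  "vertical_algebra = {A \<in> sp_algebra. \<forall>B\<in>isotropy_algebra. mat_bracket A B = 0}"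

definition horizontal_space :: "('n::finite) hvec set" where
  "horizontal_space =
     {v \<in> sphere_tangent base_point. \<forall>A\<in>vertical_algebra. inner v (A *v base_point) = 0}"

text \<open>
  The index type \<^typ>\<open>3\<close> has arithmetic modulo 3. The three elements span the vertical
  algebra, being orthonormal in a space of dimension 3.
\<close>

definition vertical_frame :: "(3 \<Rightarrow> ('n::finite) hmat) \<Rightarrow> bool" where
  "vertical_frame e \<longleftrightarrow>
     (\<forall>i. e i \<in> vertical_algebra) \<and>
     (\<forall>i j. inner (e i *v base_point) (e j *v base_point) = (if i = j then 1 else 0)) \<and>
     (\<forall>i. mat_bracket (e i) (e (i + 1)) = 2 *\<^sub>R e (i + 2))"

definition invariant_metric :: "('n::finite) hvec tensor2 \<Rightarrow> bool" where
  "invariant_metric g \<longleftrightarrow> riemannian_metric g \<and>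
     (\<forall>A\<in>Sp_group. \<forall>p\<in>sphere 0 1. \<forall>u\<in>sphere_tangent p. \<forall>v\<in>sphere_tangent p.
        g (A *v p) (A *v u) (A *v v) = g p u v)"

text \<open>
  \<^term>\<open>hopf_metric e x s g\<close>: on the sphere, \<^term>\<open>g\<close> is the invariant metric with parameters
  \<^term>\<open>x\<close>, \<^term>\<open>s\<close> relative to the vertical frame \<^term>\<open>e\<close>.
\<close>

definition hopf_metric ::
  "(3 \<Rightarrow> ('n::finite) hmat) \<Rightarrow> (3 \<Rightarrow> real) \<Rightarrow> real \<Rightarrow> 'n hvec tensor2 \<Rightarrow> bool" where
  "hopf_metric e x s g \<longleftrightarrow> invariant_metric g \<and>
     (\<forall>i j. g base_point (e i *v base_point) (e j *v base_point) = (if i = j then x i else 0)) \<and>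
     (\<forall>u\<in>horizontal_space. \<forall>v\<in>horizontal_space. g base_point u v = s * inner u v) \<and>
     (\<forall>i. \<forall>u\<in>horizontal_space. g base_point (e i *v base_point) u = 0)"

end

(*
  An invariant metric with s = 1 is the round metric plus sum t_i eta_i (x) eta_i, where t_i = x_i - 1
  and eta_i is dual to the Killing field J_i p = p q_i (right multiplication by imaginary quaternions).
  As all derivatives of eta_i are again expressed by J_i, its Levi-Civita connection is the round one
  plus an explicit tensor, and tracing the curvature over ambient coordinates gives
    Ric = sum F_i eta_i eta_i + (4n + 8 - 2 sum x_i) (<u,v> - sum eta_i eta_i),
    F_i = 2 (x_i^2 - (x_j - x_k)^2) / (x_j x_k) + 4n x_i^2.

  A solution of Ric = c T is a critical point of the scalar curvature on the metrics g with tr_g T = 1,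
  c being the Lagrange multiplier. In the inverse variables y_i = 1/x_i, z = 1/s the constraint is an
  open simplex, and the limit superior of the scalar curvature where some y_i tends to 0 is at most 0.
  On the face z = 0 the scalar curvature is at most 2 sum y_i, which b / a_i < 2n + 4 makes smaller
  than (4n + 8) / b; below this value, increasing z from 0 increases the scalar curvature, so the
  maximum is attained in the interior.
*)

theory Submission
  imports Defs
begin

section \<open>Smooth functions on the sphere\<close>

text \<open>Setting s = 1 loses nothing: Ric does not change when the metric is multiplied by a
  constant, so a critical metric may be rescaled at the end. The same scaling makes the scalar
  curvature homogeneous of degree 1 in the inverse variables, so its multiplier c is the maximal
  value itself and is positive because that maximum is. That \<open>scalar_curv\<close> is a scalar
  curvature only motivates the formula; what the argument uses is that its partial derivatives are
  the Ricci coefficients of the vertical directions and 4n times the horizontal one. The J_i are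
  right multiplications because matrices act from the left: they commute with Sp(n+1), which makes
  the deformed metrics invariant and carries the formula for T from the base point to the whole
  sphere. \<open>ricci\<close> is built on a chosen connection and a chosen basis. Hence uniqueness
  of the Levi-Civita connection and a basis-free form of the trace must precede any computation. All
  fields are ambient maps of which only values on the sphere count, so every identity has to be
  differentiated along the sphere.\<close>

lemma Ck_on_cong:
  assumes "open U" "\<And>x. x \<in> U \<Longrightarrow> f x = g x" "Ck_on k U f"
  shows "Ck_on k U g"
  using assms(2,3)
proof (induction k arbitrary: f g)
  case 0
  then show ?case using continuous_on_cong by (metis Ck_on.simps(1))
next
  case (Suc k)
  have D: "(g has_derivative frechet_derivative f (at x)) (at x)" if "x \<in> U" for x
    by (rule has_derivative_transform_within_open[where f = f, OF _ assms(1) that])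
      (use Suc.prems that in \<open>auto simp flip: frechet_derivative_works\<close>)
  have E: "frechet_derivative f (at x) v = frechet_derivative g (at x) v" if "x \<in> U" for x v
    using fun_cong[OF frechet_derivative_at[OF D[OF that]]] by simp
  have "Ck_on k U (\<lambda>x. frechet_derivative g (at x) v)" for v
    by (rule Suc.IH[OF E]) (use Suc.prems in auto)
  with D show ?case by (auto simp: differentiable_def)
qed

lemma Ck_on_Suc_imp: "Ck_on (Suc k) U f \<Longrightarrow> Ck_on k U f"
proof (induction k arbitrary: f)
  case 0
  then show ?case
    by (auto intro!: continuous_at_imp_continuous_on simp: differentiable_imp_continuous_within)
next
  case (Suc k)
  then show ?case by simp
qed

lemma Ck_on_const: "Ck_on k U (\<lambda>x. c)"
  by (induction k arbitrary: c) auto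

lemma Ck_on_SucI:
  assumes "open U" "\<And>x. x \<in> U \<Longrightarrow> (f has_derivative f' x) (at x)"
    and "\<And>v. Ck_on k U (\<lambda>x. f' x v)"
  shows "Ck_on (Suc k) U f"
proof -
  have E: "f' x v = frechet_derivative f (at x) v" if "x \<in> U" for x v
    using fun_cong[OF frechet_derivative_at[OF assms(2)[OF that]]] by simp
  have "Ck_on k U (\<lambda>x. frechet_derivative f (at x) v)" for v
    by (rule Ck_on_cong[OF assms(1) E assms(3)])
  with assms(2) show ?thesis by (auto simp: differentiable_def)
qed

lemma Ck_on_SucD:
  assumes "Ck_on (Suc k) U f" "x \<in> U"
  shows "(f has_derivative frechet_derivative f (at x)) (at x)"
  using assms by (auto simp flip: frechet_derivative_works)

lemma Ck_on_add:
  assumes "open U" "Ck_on k U f" "Ck_on k U g"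
  shows "Ck_on k U (\<lambda>x. f x + g x)"
  using assms(2,3)
proof (induction k arbitrary: f g)
  case 0
  then show ?case by (auto intro: continuous_intros)
next
  case (Suc k)
  show ?case
    by (rule Ck_on_SucI[OF assms(1) has_derivative_add[OF Ck_on_SucD Ck_on_SucD]])
      (use Suc in auto)
qed

text \<open>A single Leibniz induction covers products, scalar multiples and inner products. The
  undifferentiated factors are C^k by \<open>Ck_on_Suc_imp\<close>, so both summands of the
  derivative fall under the induction hypothesis.\<close>

lemma Ck_on_bilinear:
  assumes "open U" "bounded_bilinear B" "Ck_on k U f" "Ck_on k U g"
  shows "Ck_on k U (\<lambda>x. B (f x) (g x))"
  using assms(3,4)
proof (induction k arbitrary: f g)
  case 0
  then show ?case by (auto intro: bounded_bilinear.continuous_on[OF assms(2)])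
next
  case (Suc k)
  have "Ck_on k U f" "Ck_on k U g" using Suc.prems Ck_on_Suc_imp by blast+
  moreover have "Ck_on k U (\<lambda>x. frechet_derivative f (at x) v)"
    "Ck_on k U (\<lambda>x. frechet_derivative g (at x) v)" for v
    using Suc.prems by auto
  ultimately show ?case
    by (intro Ck_on_SucI[OF assms(1) bounded_bilinear.FDERIV[OF assms(2) Ck_on_SucD Ck_on_SucD]]
        Ck_on_add Suc assms(1) Suc.IH) (use Suc.prems in auto)
qed

lemma Ck_on_linear:
  assumes "open U" "bounded_linear L" "Ck_on k U f"
  shows "Ck_on k U (\<lambda>x. L (f x))"
  using assms(3)
proof (induction k arbitrary: f)
  case 0
  then show ?case by (auto intro: bounded_linear.continuous_on[OF assms(2)])
next
  case (Suc k)
  show ?case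
    by (rule Ck_on_SucI[OF assms(1) bounded_linear.has_derivative[OF assms(2) Ck_on_SucD]])
      (use Suc in auto)
qed

lemma Ck_on_ident: "open U \<Longrightarrow> Ck_on k U (\<lambda>x. x)"
  by (cases k) (auto intro!: Ck_on_SucI has_derivative_ident Ck_on_const continuous_on_id)

lemma open_punctured: "open (- {0 :: 'a::euclidean_space})"
  by auto

text \<open>The derivative is written as a polynomial in \<open>inverse (norm x)\<close> and
  \<open>inner x v\<close>, so that the induction on k for \<open>Ck_on_inverse_norm\<close>
  closes.\<close>

lemma has_derivative_inverse_norm:
  fixes x :: "'a::euclidean_space"
  assumes "x \<noteq> 0"
  shows "((\<lambda>x. inverse (norm x)) has_derivative
    (\<lambda>v. - (inverse (norm x) * inverse (norm x) * inverse (norm x) * inner x v))) (at x)"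
proof -
  have "(norm has_derivative (\<lambda>v. inner v (sgn x))) (at x)"
    using has_derivative_norm[OF assms] .
  from Deriv.has_derivative_inverse[OF _ this] show ?thesis
    using assms by (simp add: sgn_div_norm inner_commute ac_simps)
qed

lemma Ck_on_inverse_norm: "Ck_on k (- {0 :: 'a::euclidean_space}) (\<lambda>x. inverse (norm x))"
proof (induction k)
  case 0
  then show ?case by (auto intro!: continuous_intros)
next
  case (Suc k)
  show ?case
  proof (rule Ck_on_SucI[OF open_punctured has_derivative_inverse_norm])
    fix v :: 'a
    have "Ck_on k (- {0 :: 'a}) (\<lambda>x. - ((((inverse (norm x) * inverse (norm x)) * inverse (norm x)) * inner x v)))"
      by (intro Ck_on_linear[OF open_punctured bounded_linear_minus[OF bounded_linear_ident]]
          Ck_on_bilinear[OF open_punctured bounded_bilinear_mult]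
          Ck_on_bilinear[OF open_punctured bounded_bilinear_inner] Suc Ck_on_const
          Ck_on_ident open_punctured)
    then show "Ck_on k (- {0 :: 'a})
      (\<lambda>x. - (inverse (norm x) * inverse (norm x) * inverse (norm x) * inner x v))" .
  qed auto
qed

lemma smooth_on_sphere_cong:
  assumes "smooth_on_sphere f" "\<And>p. p \<in> sphere 0 1 \<Longrightarrow> f p = g p"
  shows "smooth_on_sphere g"
  using assms Ck_on_cong[OF open_punctured, of "\<lambda>x. f (sgn x)" "\<lambda>x. g (sgn x)"]
  by (auto simp: smooth_on_sphere_def smooth_on_def norm_sgn)

lemma smooth_on_sphere_const: "smooth_on_sphere (\<lambda>x. c)"
  by (auto simp: smooth_on_sphere_def smooth_on_def Ck_on_const)

lemma smooth_on_sphere_ident: "smooth_on_sphere (\<lambda>x::'a::euclidean_space. x)"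
  unfolding smooth_on_sphere_def smooth_on_def sgn_div_norm divide_inverse
  by (auto intro!: Ck_on_bilinear[OF open_punctured bounded_bilinear_scaleR] Ck_on_inverse_norm
     Ck_on_ident open_punctured)

lemma smooth_on_sphere_add:
  "smooth_on_sphere f \<Longrightarrow> smooth_on_sphere g \<Longrightarrow> smooth_on_sphere (\<lambda>x. f x + g x)"
  by (auto simp: smooth_on_sphere_def smooth_on_def intro!: Ck_on_add open_punctured)

lemma smooth_on_sphere_sum:
  "finite A \<Longrightarrow> (\<And>i. i \<in> A \<Longrightarrow> smooth_on_sphere (f i)) \<Longrightarrow> smooth_on_sphere (\<lambda>x. \<Sum>i\<in>A. f i x)"
  by (induction A rule: finite_induct) (auto intro: smooth_on_sphere_const smooth_on_sphere_add)

lemma smooth_on_sphere_linear: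
  "bounded_linear L \<Longrightarrow> smooth_on_sphere f \<Longrightarrow> smooth_on_sphere (\<lambda>x. L (f x))"
  by (auto simp: smooth_on_sphere_def smooth_on_def intro!: Ck_on_linear[of _ L] open_punctured)

lemma smooth_on_sphere_bilinear:
  "bounded_bilinear B \<Longrightarrow> smooth_on_sphere f \<Longrightarrow> smooth_on_sphere g \<Longrightarrow>
    smooth_on_sphere (\<lambda>x. B (f x) (g x))"
  by (auto simp: smooth_on_sphere_def smooth_on_def intro!: Ck_on_bilinear[of _ B] open_punctured)

lemmas smooth_on_sphere_minus =
  smooth_on_sphere_linear[OF bounded_linear_minus[OF bounded_linear_ident]]

lemma smooth_on_sphere_diff:
  "smooth_on_sphere f \<Longrightarrow> smooth_on_sphere g \<Longrightarrow> smooth_on_sphere (\<lambda>x. f x - g x)"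
  using smooth_on_sphere_add[OF _ smooth_on_sphere_minus] by fastforce

lemmas smooth_on_sphere_intros =
  smooth_on_sphere_const smooth_on_sphere_ident smooth_on_sphere_add smooth_on_sphere_diff
  smooth_on_sphere_minus smooth_on_sphere_bilinear[OF bounded_bilinear_mult]
  smooth_on_sphere_bilinear[OF bounded_bilinear_scaleR]
  smooth_on_sphere_bilinear[OF bounded_bilinear_inner]

section \<open>Differentiation along the sphere\<close>

lemma sphere_has_derivative:
  assumes "smooth_on_sphere f" "p \<in> sphere 0 1"
  shows "((\<lambda>x. f (sgn x)) has_derivative sphere_deriv f p) (at p)"
proof -
  have "Ck_on (Suc 0) (- {0}) (\<lambda>x. f (sgn x))"
    using assms by (auto simp: smooth_on_sphere_def smooth_on_def)
  moreover have "p \<in> - {0}" using assms by auto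
  ultimately show ?thesis
    unfolding sphere_deriv_def by (rule Ck_on_SucD)
qed

lemma sphere_derivI:
  "((\<lambda>x. f (sgn x)) has_derivative f') (at p) \<Longrightarrow> sphere_deriv f p v = f' v"
  unfolding sphere_deriv_def by (drule frechet_derivative_at) simp

lemma sphere_deriv_cong:
  assumes "smooth_on_sphere f" "p \<in> sphere 0 1" "\<And>q. q \<in> sphere 0 1 \<Longrightarrow> f q = g q"
  shows "sphere_deriv g p v = sphere_deriv f p v"
proof (rule sphere_derivI)
  show "((\<lambda>x. g (sgn x)) has_derivative sphere_deriv f p) (at p)"
    by (rule has_derivative_transform_within_open[OF sphere_has_derivative[OF assms(1,2)] open_punctured])
      (use assms in \<open>auto simp: norm_sgn\<close>)
qed

lemma sgn_sphere: "p \<in> sphere 0 1 \<Longrightarrow> sgn p = (p::'a::euclidean_space)"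
  by (simp add: sgn_div_norm)

lemma linear_sphere_deriv:
  "smooth_on_sphere f \<Longrightarrow> p \<in> sphere 0 1 \<Longrightarrow> linear (sphere_deriv f p)"
  using sphere_has_derivative has_derivative_linear by blast

lemma sphere_deriv_const: "sphere_deriv (\<lambda>x. c) p v = 0"
  by (rule sphere_derivI) auto

lemma sphere_deriv_ident:
  fixes p :: "'a::euclidean_space"
  assumes "p \<in> sphere 0 1" "v \<in> sphere_tangent p"
  shows "sphere_deriv (\<lambda>x. x) p v = v"
proof -
  have "((\<lambda>x. inverse (norm x) *\<^sub>R x) has_derivative
    (\<lambda>v. inverse (norm p) *\<^sub>R v + (- (inverse (norm p) * inverse (norm p) * inverse (norm p) * inner p v)) *\<^sub>R p)) (at p)"
    by (rule has_derivative_scaleR[OF has_derivative_inverse_norm has_derivative_ident])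
      (use assms in auto)
  then have "((\<lambda>x. sgn x) has_derivative (\<lambda>v. v - inner p v *\<^sub>R p)) (at p)"
    using assms(1) by (simp add: sgn_div_norm divide_inverse)
  from sphere_derivI[of "\<lambda>x. x", OF this] show ?thesis
    using assms by (simp add: sphere_tangent_def)
qed

lemma sphere_deriv_add:
  "smooth_on_sphere f \<Longrightarrow> smooth_on_sphere g \<Longrightarrow> p \<in> sphere 0 1 \<Longrightarrow>
    sphere_deriv (\<lambda>x. f x + g x) p v = sphere_deriv f p v + sphere_deriv g p v"
  by (rule sphere_derivI) (intro has_derivative_add sphere_has_derivative)

lemma sphere_deriv_diff:
  "smooth_on_sphere f \<Longrightarrow> smooth_on_sphere g \<Longrightarrow> p \<in> sphere 0 1 \<Longrightarrow>
    sphere_deriv (\<lambda>x. f x - g x) p v = sphere_deriv f p v - sphere_deriv g p v"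
  by (rule sphere_derivI) (intro has_derivative_diff sphere_has_derivative)

lemma sphere_deriv_minus:
  "smooth_on_sphere f \<Longrightarrow> p \<in> sphere 0 1 \<Longrightarrow>
    sphere_deriv (\<lambda>x. - f x) p v = - sphere_deriv f p v"
  by (rule sphere_derivI) (intro has_derivative_minus sphere_has_derivative)

lemma sphere_deriv_linear:
  "bounded_linear L \<Longrightarrow> smooth_on_sphere f \<Longrightarrow> p \<in> sphere 0 1 \<Longrightarrow>
    sphere_deriv (\<lambda>x. L (f x)) p v = L (sphere_deriv f p v)"
  by (rule sphere_derivI) (rule bounded_linear.has_derivative[OF _ sphere_has_derivative])

lemma sphere_deriv_bilinear:
  fixes f :: "'a::euclidean_space \<Rightarrow> 'b::real_normed_vector" and g :: "'a \<Rightarrow> 'c::real_normed_vector"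
  assumes "bounded_bilinear B" "smooth_on_sphere f" "smooth_on_sphere g" "p \<in> sphere 0 1"
  shows "sphere_deriv (\<lambda>x. B (f x) (g x)) p v =
    B (f p) (sphere_deriv g p v) + B (sphere_deriv f p v) (g p)"
  using sphere_derivI[of "\<lambda>x. B (f x) (g x)", OF bounded_bilinear.FDERIV[OF assms(1)
      sphere_has_derivative[OF assms(2,4)] sphere_has_derivative[OF assms(3,4)]]]
  by (simp only: sgn_sphere[OF assms(4)])

lemma sphere_deriv_sum:
  "finite A \<Longrightarrow> p \<in> sphere 0 1 \<Longrightarrow> (\<And>i. i \<in> A \<Longrightarrow> smooth_on_sphere (f i)) \<Longrightarrow>
    sphere_deriv (\<lambda>x. \<Sum>i\<in>A. f i x) p v = (\<Sum>i\<in>A. sphere_deriv (f i) p v)"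
  by (induction A rule: finite_induct)
    (auto simp: sphere_deriv_const sphere_deriv_add smooth_on_sphere_sum)

lemmas sphere_deriv_rules =
  sphere_deriv_const sphere_deriv_add sphere_deriv_diff sphere_deriv_minus
  sphere_deriv_bilinear[OF bounded_bilinear_mult] sphere_deriv_bilinear[OF bounded_bilinear_scaleR]
  sphere_deriv_bilinear[OF bounded_bilinear_inner]

text \<open>The pullback by the radial retraction is homogeneous of degree 0, which reduces smoothness of
  \<^term>\<open>sphere_deriv f\<close> along the sphere to that of the partial derivatives off the origin.\<close>

lemma sphere_deriv_sgn:
  fixes f :: "'a::euclidean_space \<Rightarrow> 'b::real_normed_vector"
  assumes "smooth_on_sphere f" "x \<noteq> 0"
  shows "sphere_deriv f (sgn x) v = frechet_derivative (\<lambda>y. f (sgn y)) (at x) (norm x *\<^sub>R v)"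
proof -
  let ?F = "\<lambda>y. f (sgn y)"
  have "Ck_on (Suc 0) (- {0}) ?F"
    using assms by (auto simp: smooth_on_sphere_def smooth_on_def)
  then have "(?F has_derivative frechet_derivative ?F (at x)) (at x)"
    by (rule Ck_on_SucD) (use assms in auto)
  then have "(?F has_derivative frechet_derivative ?F (at x)) (at (norm x *\<^sub>R sgn x))"
    using assms by (simp add: sgn_div_norm)
  moreover have "((\<lambda>y. norm x *\<^sub>R y) has_derivative (\<lambda>v. norm x *\<^sub>R v)) (at (sgn x))"
    by (auto intro!: derivative_eq_intros)
  ultimately have "((\<lambda>y. ?F (norm x *\<^sub>R y)) has_derivative
      (\<lambda>v. frechet_derivative ?F (at x) (norm x *\<^sub>R v))) (at (sgn x))"
    using has_derivative_compose[of "\<lambda>y. norm x *\<^sub>R y" _ "sgn x" UNIV ?F] by simp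
  moreover have "?F (norm x *\<^sub>R y) = ?F y" for y
    using assms by (simp add: sgn_scaleR)
  ultimately show ?thesis
    by (intro sphere_derivI) simp
qed

lemma smooth_on_sphere_deriv:
  fixes f :: "'a::euclidean_space \<Rightarrow> 'b::real_normed_vector"
  assumes f: "smooth_on_sphere f" and X: "smooth_on_sphere X"
  shows "smooth_on_sphere (\<lambda>p. sphere_deriv f p (X p))"
proof -
  let ?F' = "\<lambda>x. frechet_derivative (\<lambda>y. f (sgn y)) (at x)"
  \<comment> \<open>The factor \<open>inner x x * inverse (norm x)\<close> is \<open>norm x\<close>,
    the homogeneity factor of \<open>sphere_deriv_sgn\<close>, written with functions already known
    to be C^k.\<close>
  define h where "h x = (\<Sum>b\<in>Basis. ((inner x x * inverse (norm x)) * inner (X (sgn x)) b) *\<^sub>R ?F' x b)" for x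
  have Xs: "Ck_on k (- {0}) (\<lambda>x. X (sgn x))" for k
    using X by (auto simp: smooth_on_sphere_def smooth_on_def)
  have F's: "Ck_on k (- {0}) (\<lambda>x. ?F' x b)" for k b
    using f unfolding smooth_on_sphere_def smooth_on_def by (metis Ck_on.simps(2))
  have sum: "finite A \<Longrightarrow> (\<And>i. i \<in> A \<Longrightarrow> Ck_on k (-{0}) (H i)) \<Longrightarrow> Ck_on k (-{0}) (\<lambda>x. \<Sum>i\<in>A. H i x)"
    for k A and H :: "'a \<Rightarrow> 'a \<Rightarrow> 'b"
    by (induction A rule: finite_induct) (auto intro: Ck_on_const Ck_on_add)
  have hs: "Ck_on k (- {0}) h" for k
    unfolding h_def
    by (intro sum Ck_on_bilinear[OF open_punctured bounded_bilinear_mult]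
        Ck_on_bilinear[OF open_punctured bounded_bilinear_scaleR]
        Ck_on_bilinear[OF open_punctured bounded_bilinear_inner] Ck_on_const
        Ck_on_ident open_punctured Ck_on_inverse_norm Xs F's) auto
  have h: "h x = sphere_deriv f (sgn x) (X (sgn x))" if "x \<in> - {0}" for x
  proof -
    have "Ck_on (Suc 0) (- {0}) (\<lambda>y. f (sgn y))"
      using f by (auto simp: smooth_on_sphere_def smooth_on_def)
    then have "linear (?F' x)"
      using that Ck_on_SucD has_derivative_linear by blast
    then have "?F' x (norm x *\<^sub>R X (sgn x)) = (\<Sum>b\<in>Basis. (norm x * inner (X (sgn x)) b) *\<^sub>R ?F' x b)"
      by (subst euclidean_representation[of "norm x *\<^sub>R X (sgn x)", symmetric])
        (simp add: linear_sum linear_cmul)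
    moreover have "inner x x * inverse (norm x) = norm x"
      using that by (simp add: norm_eq_sqrt_inner) (metis abs_of_nonneg divide_inverse inner_ge_zero real_sqrt_abs real_div_sqrt)
    ultimately show ?thesis
      using sphere_deriv_sgn[OF f, of x] that by (simp add: h_def)
  qed
  have "Ck_on k (- {0}) (\<lambda>x. sphere_deriv f (sgn x) (X (sgn x)))" for k
    by (rule Ck_on_cong[OF open_punctured h hs])
  then show ?thesis
    by (simp add: smooth_on_sphere_def smooth_on_def)
qed

section \<open>Traces, and uniqueness of the Levi-Civita connection\<close>

text \<open>For linear \<open>f\<close> this is the trace of the compression of \<open>f\<close> to
  the tangent space at a unit vector \<open>p\<close>: the ambient trace without its radial
  entry.\<close>

definition tangent_trace :: "'a::euclidean_space \<Rightarrow> ('a \<Rightarrow> 'a) \<Rightarrow> real" where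
  "tangent_trace p f = (\<Sum>b\<in>Basis. inner (f b) b) - inner (f p) p"

lemma subspace_sphere_tangent: "subspace (sphere_tangent p)"
  by (auto simp: subspace_def sphere_tangent_def inner_simps)

text \<open>With P the orthogonal projection along \<open>p\<close>, both sides are the trace of
  \<open>L'\<close> composed with P, once in a tangent basis and once in the ambient one; exchanging
  the two sums identifies them. Only agreement with a linear map on tangent vectors is asked of
  \<open>L\<close>, since the curvature through \<open>tangent_ext\<close> is not known in other
  directions.\<close>

lemma trace_on_sphere_tangent:
  fixes p :: "'a::euclidean_space"
  assumes p: "p \<in> sphere 0 1" and L': "linear L'"
    and eq: "\<And>w. w \<in> sphere_tangent p \<Longrightarrow> L w = L' w"
    and tan: "\<And>w. w \<in> sphere_tangent p \<Longrightarrow> L w \<in> sphere_tangent p"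
  shows "trace_on (sphere_tangent p) L = tangent_trace p L'"
proof -
  define V where "V = sphere_tangent p"
  define B where "B = (SOME B. independent B \<and> span B = V)"
  have "\<exists>B. independent B \<and> span B = V"
    using basis_exists[of V] subspace_sphere_tangent[of p]
    by (metis V_def span_subspace)
  then have "independent B \<and> span B = V"
    unfolding B_def by (rule someI_ex)
  then have B: "independent B" "span B = V" "finite B"
    using independent_imp_finite by auto
  have BV: "b \<in> V" if "b \<in> B" for b using B that span_base by blast
  define P where "P x = x - inner x p *\<^sub>R p" for x
  have pp: "inner p p = 1" using p by (simp add: norm_eq_1)
  have PV: "P x \<in> V" for x by (simp add: P_def V_def sphere_tangent_def inner_simps pp inner_commute)
  have P_V: "P x = x" if "x \<in> V" for x
    using that by (simp add: P_def V_def sphere_tangent_def inner_commute)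
  define \<phi> where "\<phi> b x = representation B (P x) b" for b x
  have lin: "linear (\<phi> b)" for b
  proof (rule linearI)
    fix x y :: 'a and r :: real
    have "P (x + y) = P x + P y" "P (r *\<^sub>R x) = r *\<^sub>R P x"
      by (simp_all add: P_def inner_simps algebra_simps)
    then show "\<phi> b (x + y) = \<phi> b x + \<phi> b y" "\<phi> b (r *\<^sub>R x) = r *\<^sub>R \<phi> b x"
      using B PV by (simp_all add: \<phi>_def representation_add representation_scale)
  qed
  have rep: "P x = (\<Sum>b\<in>B. \<phi> b x *\<^sub>R b)" for x
    using sum_representation_eq[OF B(1), of "P x" B] B PV by (simp add: \<phi>_def)
  have "trace_on V L = (\<Sum>b\<in>B. representation B (L b) b)"
    by (simp add: trace_on_def B_def Let_def)
  also have "\<dots> = (\<Sum>b\<in>B. \<phi> b (L' b))"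
    using BV eq tan P_V by (intro sum.cong) (auto simp: \<phi>_def V_def)
  also have "\<dots> = (\<Sum>b\<in>B. \<Sum>d\<in>Basis. inner (L' b) d * \<phi> b d)"
  proof (intro sum.cong refl)
    fix b assume "b \<in> B"
    have "\<phi> b (L' b) = \<phi> b (\<Sum>d\<in>Basis. inner (L' b) d *\<^sub>R d)"
      by (simp add: euclidean_representation)
    then show "\<phi> b (L' b) = (\<Sum>d\<in>Basis. inner (L' b) d * \<phi> b d)"
      by (simp add: linear_sum[OF lin] linear_cmul[OF lin])
  qed
  also have "\<dots> = (\<Sum>d\<in>Basis. \<Sum>b\<in>B. inner (L' b) d * \<phi> b d)"
    by (rule sum.swap)
  also have "\<dots> = (\<Sum>d\<in>Basis. inner (L' (P d)) d)"
    by (simp add: rep linear_sum[OF L'] linear_cmul[OF L'] inner_sum_left mult.commute)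
  also have "\<dots> = (\<Sum>d\<in>Basis. inner (L' d) d) - (\<Sum>d\<in>Basis. inner d p * inner (L' p) d)"
    by (simp add: P_def linear_diff[OF L'] linear_cmul[OF L'] inner_simps sum_subtractf)
  also have "(\<Sum>d\<in>Basis. inner d p * inner (L' p) d) = inner (L' p) p"
    by (subst euclidean_inner) (simp add: inner_commute mult.commute)
  finally show ?thesis
    by (simp add: tangent_trace_def V_def)
qed

lemma tangent_trace_add:
  "tangent_trace p (\<lambda>w. f w + g w) = tangent_trace p f + tangent_trace p g"
  by (simp add: tangent_trace_def inner_simps sum.distrib)

lemma tangent_trace_diff:
  "tangent_trace p (\<lambda>w. f w - g w) = tangent_trace p f - tangent_trace p g"
  by (simp add: tangent_trace_def inner_simps sum_subtractf)

lemma tangent_trace_scale: "tangent_trace p (\<lambda>w. c *\<^sub>R f w) = c * tangent_trace p f"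
  by (simp add: tangent_trace_def inner_simps sum_distrib_left right_diff_distrib)

lemma tangent_trace_minus: "tangent_trace p (\<lambda>w. - f w) = - tangent_trace p f"
  by (simp add: tangent_trace_def inner_simps sum_negf)

lemma tangent_trace_sum: "tangent_trace p (\<lambda>w. \<Sum>i\<in>A. f i w) = (\<Sum>i\<in>A. tangent_trace p (f i))"
  by (induction A rule: infinite_finite_induct)
    (simp_all add: tangent_trace_add, simp_all add: tangent_trace_def)

lemma tangent_trace_ident:
  "p \<in> sphere 0 1 \<Longrightarrow> tangent_trace p (\<lambda>w. w) = real DIM('a) - 1" for p :: "'a::euclidean_space"
  by (simp add: tangent_trace_def norm_eq_1)

lemma tangent_trace_skew:
  assumes "\<And>x y. inner (f x) y = - inner x (f y)"
  shows "tangent_trace p f = 0"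
proof -
  have "inner (f x) x = 0" for x using assms[of x x] by (simp add: inner_commute)
  then show ?thesis by (simp add: tangent_trace_def)
qed

text \<open>Together with the traces of the identity and of \<open>J i\<close>, this evaluates every
  contraction of the curvature below.\<close>

lemma tangent_trace_rank_one:
  assumes "linear f"
  shows "tangent_trace p (\<lambda>w. f w *\<^sub>R a) = f a - inner a p * f p"
proof -
  have "f a = f (\<Sum>b\<in>Basis. inner a b *\<^sub>R b)" by (simp add: euclidean_representation)
  also have "\<dots> = (\<Sum>b\<in>Basis. f b * inner a b)"
    by (simp add: linear_sum[OF assms] linear_cmul[OF assms] mult.commute)
  finally show ?thesis by (simp add: tangent_trace_def)
qed

lemma linear_scalar_rules:
  fixes f g :: "'a::real_inner \<Rightarrow> real"
  shows "linear f \<Longrightarrow> linear g \<Longrightarrow> linear (\<lambda>w. f w + g w)" "linear f \<Longrightarrow> linear g \<Longrightarrow> linear (\<lambda>w. f w - g w)"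
    "linear f \<Longrightarrow> linear (\<lambda>w. r * f w)" "linear f \<Longrightarrow> linear (\<lambda>w. f w * r)"
    "linear (\<lambda>w. inner z w)" "linear (\<lambda>w. inner w z)" "linear h \<Longrightarrow> linear (\<lambda>w. inner z (h w))"
    "linear h \<Longrightarrow> linear (\<lambda>w. inner (h w) z)"
  by (auto intro!: linearI simp: linear_add linear_cmul inner_simps algebra_simps)

section \<open>Vector fields and tangent extensions\<close>

lemma vector_field_diff:
  assumes "vector_field X" "vector_field Y"
  shows "vector_field (\<lambda>q. X q - Y q)"
  using assms by (auto simp: vector_field_def sphere_tangent_def inner_simps intro: smooth_on_sphere_diff)

lemma vector_field_cong:
  assumes "vector_field X" "\<And>q. q \<in> sphere 0 1 \<Longrightarrow> X q = Y q"
  shows "vector_field Y"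
  using assms smooth_on_sphere_cong[of X Y] by (auto simp: vector_field_def)

lemma vector_field_tangent_ext: "vector_field (tangent_ext v)"
  unfolding vector_field_def tangent_ext_def
  by (auto intro!: smooth_on_sphere_intros simp: sphere_tangent_def inner_simps norm_eq_1)

lemma tangent_ext_tangent: "v \<in> sphere_tangent p \<Longrightarrow> tangent_ext v p = v"
  by (simp add: tangent_ext_def sphere_tangent_def)

lemma tangent_ext_in: "p \<in> sphere 0 1 \<Longrightarrow> tangent_ext v p \<in> sphere_tangent p"
  using vector_field_tangent_ext vector_field_def by blast

lemma sphere_deriv_tangent_ext:
  assumes "p \<in> sphere 0 1" "w \<in> sphere_tangent p"
  shows "sphere_deriv (tangent_ext v) p w = - inner p v *\<^sub>R w - inner w v *\<^sub>R p"
  unfolding tangent_ext_def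
  using assms
  by (simp add: sphere_deriv_rules smooth_on_sphere_intros sphere_deriv_ident)

text \<open>Differentiate \<open>inner q (Y q) = 0\<close>. This normal component is what the term
  \<open>inner (X p) (Y p) *\<^sub>R p\<close> of \<open>conn\<close> compensates.\<close>

lemma inner_sphere_deriv:
  assumes "vector_field Y" "p \<in> sphere 0 1" "u \<in> sphere_tangent p"
  shows "inner p (sphere_deriv Y p u) = - inner u (Y p)"
proof -
  have Y: "smooth_on_sphere Y" using assms by (simp add: vector_field_def)
  have "sphere_deriv (\<lambda>q. inner q (Y q)) p u = inner p (sphere_deriv Y p u) + inner u (Y p)"
    using assms by (simp add: sphere_deriv_rules smooth_on_sphere_intros Y sphere_deriv_ident)
  moreover have "sphere_deriv (\<lambda>q. inner q (Y q)) p u = sphere_deriv (\<lambda>q. 0) p u"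
    by (rule sphere_deriv_cong)
      (use assms in \<open>auto simp: vector_field_def sphere_tangent_def intro: smooth_on_sphere_const\<close>)
  ultimately show ?thesis by (simp add: sphere_deriv_const)
qed

text \<open>The difference of two Levi-Civita connections is symmetric in its first two and
  antisymmetric in its last two arguments.\<close>

lemma levi_civita_unique:
  assumes g: "riemannian_metric g" and D: "is_levi_civita g D" and D': "is_levi_civita g D'"
    and X: "vector_field X" and Y: "vector_field Y" and p: "p \<in> sphere 0 1"
  shows "D X Y p = D' X Y p"
proof -
  have vf: "vector_field (D X Y)" "vector_field (D' X Y)" if "vector_field X" "vector_field Y" for X Y
    using D D' that by (auto simp: is_levi_civita_def affine_connection_def)
  have tan: "D X Y p \<in> sphere_tangent p" "D' X Y p \<in> sphere_tangent p" "X p \<in> sphere_tangent p"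
    if "vector_field X" "vector_field Y" for X Y
    using vf[OF that] that p by (auto simp: vector_field_def)
  have g_add: "g p (u + v) w = g p u w + g p v w" and g_scale: "g p (r *\<^sub>R u) w = r * g p u w"
    and g_sym: "g p u w = g p w u" and g_pos: "u \<noteq> 0 \<Longrightarrow> g p u u > 0"
    if "u \<in> sphere_tangent p" "v \<in> sphere_tangent p" "w \<in> sphere_tangent p" for u v w r
    using g p that by (auto simp: riemannian_metric_def)
  have g_diff: "g p (u - v) w = g p u w - g p v w"
    if "u \<in> sphere_tangent p" "v \<in> sphere_tangent p" "w \<in> sphere_tangent p" for u v w
    using g_add[of u "-1 *\<^sub>R v" w] g_scale[of v v w "-1"] that
    by (simp add: subspace_neg[OF subspace_sphere_tangent])
  define A where "A X Y = D X Y p - D' X Y p" for X Y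
  have A_tan: "A X Y \<in> sphere_tangent p" if "vector_field X" "vector_field Y" for X Y
    unfolding A_def using tan[OF that] subspace_sphere_tangent subspace_diff by blast
  have LC: "E X Y p - E Y X p = vf_bracket X Y p"
    "sphere_deriv (\<lambda>q. g q (Y q) (Z q)) p (X p) = g p (E X Y p) (Z p) + g p (Y p) (E X Z p)"
    if "is_levi_civita g E" "vector_field X" "vector_field Y" "vector_field Z" for E X Y Z
    using that p unfolding is_levi_civita_def by blast+
  have A_sym: "A X Y = A Y X" if "vector_field X" "vector_field Y" for X Y
  proof -
    have "D X Y p - D Y X p = D' X Y p - D' Y X p"
      using LC(1)[OF D that that(1)] LC(1)[OF D' that that(1)] by simp
    then show ?thesis unfolding A_def by (simp add: algebra_simps)
  qed
  have A_anti: "g p (A X Y) (Z p) = - g p (A X Z) (Y p)"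
    if "vector_field X" "vector_field Y" "vector_field Z" for X Y Z
  proof -
    have "g p (D X Y p) (Z p) + g p (Y p) (D X Z p) = g p (D' X Y p) (Z p) + g p (Y p) (D' X Z p)"
      using LC(2)[OF D that] LC(2)[OF D' that] by simp
    then have "g p (D X Y p) (Z p) - g p (D' X Y p) (Z p) = g p (D' X Z p) (Y p) - g p (D X Z p) (Y p)"
      using g_sym[OF tan(3)[OF that(2,1)] tan(3)[OF that(2,1)] tan(1)[OF that(1,3)]]
        g_sym[OF tan(3)[OF that(2,1)] tan(3)[OF that(2,1)] tan(2)[OF that(1,3)]] by simp
    then show ?thesis
      unfolding A_def
      using g_diff[OF tan(1)[OF that(1,2)] tan(2)[OF that(1,2)] tan(3)[OF that(3,1)]]
        g_diff[OF tan(1)[OF that(1,3)] tan(2)[OF that(1,3)] tan(3)[OF that(2,1)]] by simp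
  qed
  \<comment> \<open>\<open>Z\<close> extends the value of the difference itself, so the vanishing of
    \<open>g p (A X Y) (Z p)\<close> forces \<open>A X Y = 0\<close>. Alternating the two symmetries
    three times returns to the start with the opposite sign.\<close>
  define Z where "Z = tangent_ext (A X Y)"
  have Z: "vector_field Z" by (simp add: Z_def vector_field_tangent_ext)
  have "g p (A X Y) (Z p) = - g p (A X Y) (Z p)"
    using A_anti[OF X Y Z] A_anti[OF Y X Z] A_anti[OF Z X Y]
    by (simp add: A_sym[OF Y X] A_sym[OF X Z] A_sym[OF Y Z])
  moreover have "Z p = A X Y"
    unfolding Z_def by (rule tangent_ext_tangent[OF A_tan[OF X Y]])
  ultimately have "A X Y = 0"
    using g_pos[OF A_tan A_tan A_tan] X Y by force
  then show ?thesis by (simp add: A_def)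
qed

lemma is_levi_civita_levi_civita: "is_levi_civita g D \<Longrightarrow> is_levi_civita g (levi_civita g)"
  unfolding levi_civita_def by (rule someI[of "is_levi_civita g"])

section \<open>Ricci curvature of the deformed round metrics\<close>

text \<open>The signs of the products are those of right multiplications, which reverse the order of
  quaternions.\<close>

locale quaternionic_structure =
  fixes J :: "3 \<Rightarrow> 'a::euclidean_space \<Rightarrow> 'a"
  assumes linear_J: "linear (J i)"
    and J_skew: "inner (J i u) v = - inner u (J i v)"
    and J_square: "J i (J i u) = - u"
    and J_mult: "J i (J (i + 1) u) = - J (i + 2) u"
    and J_mult': "J (i + 1) (J i u) = J (i + 2) u"

lemma three_add: "(1::3) + 1 = 2" "(1::3) + 2 = 3" "(2::3) + 1 = 3" "(2::3) + 2 = 1"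
  "(3::3) + 1 = 1" "(3::3) + 2 = 2"
  by simp_all

context quaternionic_structure
begin

lemma bounded_linear_J: "bounded_linear (J i)"
  using linear_J linear_conv_bounded_linear by blast

lemma J_simps:
  "J i (u + v) = J i u + J i v" "J i (u - v) = J i u - J i v" "J i (- u) = - J i u"
  "J i (r *\<^sub>R u) = r *\<^sub>R J i u" "J i 0 = 0"
  by (auto simp: linear_add linear_diff linear_neg linear_cmul linear_0 linear_J)

lemma J_table:
  "J 1 (J 1 u) = - u" "J 2 (J 2 u) = - u" "J 3 (J 3 u) = - u"
  "J 1 (J 2 u) = - J 3 u" "J 2 (J 3 u) = - J 1 u" "J 3 (J 1 u) = - J 2 u"
  "J 2 (J 1 u) = J 3 u" "J 3 (J 2 u) = J 1 u" "J 1 (J 3 u) = J 2 u"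
  using J_square J_mult[of 1 u] J_mult[of 2 u] J_mult[of 3 u]
    J_mult'[of 1 u] J_mult'[of 2 u] J_mult'[of 3 u]
  by (simp_all only: three_add)

lemma inner_J_same [simp]: "inner u (J i u) = 0"
  using J_skew[of i u u] by (simp add: inner_commute)

end

locale hopf_deformation = quaternionic_structure J
  for J :: "3 \<Rightarrow> 'a::euclidean_space \<Rightarrow> 'a" +
  fixes x :: "3 \<Rightarrow> real"
  assumes x_pos: "x i > 0"
begin

section \<open>The deformed metric and its Levi-Civita connection\<close>

definition t :: "3 \<Rightarrow> real" where "t i = x i - 1"

definition c :: "3 \<Rightarrow> real" where "c i = t i / x i * (t (i + 2) - t (i + 1))"

definition metric :: "'a tensor2" where
  "metric p u v = inner u v + (\<Sum>i\<in>UNIV. t i * (inner u (J i p) * inner v (J i p)))"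

text \<open>The difference of the Levi-Civita connections of \<^term>\<open>metric\<close> and of the round metric,
  found by solving \<open>metric_diff_tensor\<close> below, which is the Koszul formula; the terms with
  \<^term>\<open>c\<close> arise from inverting \<^term>\<open>metric\<close> on the vertical space.\<close>

definition diff_tensor :: "'a \<Rightarrow> 'a \<Rightarrow> 'a \<Rightarrow> 'a" where
  "diff_tensor p u v = (\<Sum>i\<in>UNIV.
     t i *\<^sub>R (inner v (J i p) *\<^sub>R J i u + inner u (J i p) *\<^sub>R J i v
       + (2 * (inner u (J i p) * inner v (J i p))) *\<^sub>R p)
     - (c i * (inner u (J (i + 1) p) * inner v (J (i + 2) p)
       + inner u (J (i + 2) p) * inner v (J (i + 1) p))) *\<^sub>R J i p)"

text \<open>The first two summands are the round connection: the flat derivative with its normal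
  component removed.\<close>

definition conn :: "'a connection" where
  "conn X Y p = sphere_deriv Y p (X p) + inner (X p) (Y p) *\<^sub>R p + diff_tensor p (X p) (Y p)"

lemma inner_JJ:
  assumes "p \<in> sphere 0 1"
  shows "inner (J i p) (J j p) = (if i = j then 1 else 0)"
proof -
  have *: "inner (J i p) (J j p) = - inner p (J i (J j p))" by (rule J_skew)
  show ?thesis
    unfolding * using assms exhaust_3[of i] exhaust_3[of j]
    by (auto simp: J_table norm_eq_1)
qed

lemma diff_tensor_commute: "diff_tensor p u v = diff_tensor p v u"
  unfolding diff_tensor_def by (intro sum.cong) (simp_all add: mult.commute add.commute)

lemma diff_tensor_linear:
  "diff_tensor p (u + v) w = diff_tensor p u w + diff_tensor p v w"
  "diff_tensor p u (v + w) = diff_tensor p u v + diff_tensor p u w"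
  "diff_tensor p (r *\<^sub>R u) w = r *\<^sub>R diff_tensor p u w"
  "diff_tensor p u (r *\<^sub>R w) = r *\<^sub>R diff_tensor p u w"
proof -
  show *: "diff_tensor p (u + v) w = diff_tensor p u w + diff_tensor p v w" for u v w
    unfolding diff_tensor_def sum.distrib[symmetric]
    by (intro sum.cong) (simp_all add: J_simps inner_simps algebra_simps)
  show "diff_tensor p u (v + w) = diff_tensor p u v + diff_tensor p u w"
    using *[of v w u] by (simp only: diff_tensor_commute[of p u])
  show **: "diff_tensor p (r *\<^sub>R u) w = r *\<^sub>R diff_tensor p u w" for u w r
    unfolding diff_tensor_def scaleR_sum_right
    by (intro sum.cong) (simp_all add: J_simps inner_simps algebra_simps)
  show "diff_tensor p u (r *\<^sub>R w) = r *\<^sub>R diff_tensor p u w"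
    using **[of r w u] by (simp only: diff_tensor_commute[of p u])
qed

lemma diff_tensor_tangent:
  assumes "p \<in> sphere 0 1" "u \<in> sphere_tangent p" "v \<in> sphere_tangent p"
  shows "diff_tensor p u v \<in> sphere_tangent p"
proof -
  have "inner (diff_tensor p u v) p = 0"
    unfolding diff_tensor_def inner_sum_left using assms(1)
    by (intro sum.neutral ballI) (simp add: inner_simps J_skew norm_eq_1)
  then show ?thesis by (simp add: sphere_tangent_def inner_commute)
qed

lemma inner_J_cross:
  "inner (J 1 u) (J 2 p) = inner u (J 3 p)" "inner (J 2 u) (J 3 p) = inner u (J 1 p)"
  "inner (J 3 u) (J 1 p) = inner u (J 2 p)" "inner (J 2 u) (J 1 p) = - inner u (J 3 p)"
  "inner (J 3 u) (J 2 p) = - inner u (J 1 p)" "inner (J 1 u) (J 3 p) = - inner u (J 2 p)"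
  "inner (J 1 u) (J 1 p) = inner u p" "inner (J 2 u) (J 2 p) = inner u p" "inner (J 3 u) (J 3 p) = inner u p"
  by (simp_all add: J_skew J_table inner_simps)

text \<open>The rotations by the two other \<open>J j\<close> contribute
  \<open>t (i + 2) - t (i + 1)\<close>, from which \<open>c i\<close> removes the fraction
  \<open>t i / x i\<close>. As \<open>x i - t i = 1\<close>, the fraction left is
  \<open>1 / x i\<close>.\<close>

lemma inner_diff_tensor_J:
  assumes "p \<in> sphere 0 1" "u \<in> sphere_tangent p" "v \<in> sphere_tangent p"
  shows "inner (diff_tensor p u v) (J i p) = (t (i + 2) - t (i + 1)) / x i *
    (inner u (J (i + 1) p) * inner v (J (i + 2) p) + inner u (J (i + 2) p) * inner v (J (i + 1) p))"
proof -
  have [simp]: "inner u p = 0" "inner v p = 0"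
    using assms by (simp_all add: sphere_tangent_def inner_commute)
  have "inner (diff_tensor p u v) (J i p) = (t (i + 2) - t (i + 1) - c i) *
    (inner u (J (i + 1) p) * inner v (J (i + 2) p) + inner u (J (i + 2) p) * inner v (J (i + 1) p))"
    using exhaust_3[of i] unfolding diff_tensor_def sum_3 three_add
    by (elim disjE; simp only: three_add)
      (simp_all add: inner_simps inner_J_cross inner_JJ[OF assms(1)] algebra_simps)
  moreover have "t (i + 2) - t (i + 1) - c i = (t (i + 2) - t (i + 1)) / x i"
    using x_pos[of i] by (simp add: c_def t_def[of i] field_simps)
  ultimately show ?thesis by simp
qed

text \<open>This is where the choice of \<open>c\<close> pays off: \<open>t i\<close> times the
  vertical component of the difference tensor is exactly the \<open>c i\<close> term, and the two
  cancel.\<close>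

lemma metric_diff_tensor:
  assumes "p \<in> sphere 0 1" "u \<in> sphere_tangent p" "v \<in> sphere_tangent p" "w \<in> sphere_tangent p"
  shows "metric p (diff_tensor p u v) w =
    (\<Sum>i\<in>UNIV. t i * (inner v (J i p) * inner (J i u) w + inner u (J i p) * inner (J i v) w))"
proof -
  have "inner p w = 0" using assms by (simp add: sphere_tangent_def)
  have *: "t i * (inner (diff_tensor p u v) (J i p) * r) = c i * (inner u (J (i + 1) p) * inner v (J (i + 2) p)
      + inner u (J (i + 2) p) * inner v (J (i + 1) p)) * r" for i r
    by (simp add: inner_diff_tensor_J[OF assms(1-3)] c_def)
  show ?thesis
    unfolding metric_def *
    unfolding diff_tensor_def inner_sum_left sum.distrib[symmetric]
    by (intro sum.cong)
      (simp_all add: inner_simps inner_commute[of "J _ p" w] \<open>inner p w = 0\<close>)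
qed

lemma metric_add: "metric p (u + v) w = metric p u w + metric p v w"
  by (simp add: metric_def inner_simps algebra_simps sum.distrib)

lemma metric_commute: "metric p u v = metric p v u"
  by (simp add: metric_def inner_commute mult.commute)

lemma metric_scale: "metric p (r *\<^sub>R u) w = r * metric p u w"
  by (simp add: metric_def inner_simps algebra_simps sum_distrib_left)

text \<open>Splitting off the components along \<open>J i p\<close> leaves the weights
  \<open>1 + t i = x i\<close>, so the metric is a sum of nonnegative terms with positive
  coefficients.\<close>

lemma metric_pos:
  assumes p: "p \<in> sphere 0 1" and "u \<noteq> 0"
  shows "metric p u u > 0"
proof -
  define h where "h = u - (\<Sum>i\<in>UNIV. inner u (J i p) *\<^sub>R J i p)"
  have hJ: "inner h (J i p) = 0" for i
    using exhaust_3[of i] unfolding h_def sum_3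
    by (auto simp: inner_simps inner_JJ[OF p])
  have u: "u = h + (\<Sum>i\<in>UNIV. inner u (J i p) *\<^sub>R J i p)" by (simp add: h_def)
  have "inner u u = inner u h + inner u (\<Sum>i\<in>UNIV. inner u (J i p) *\<^sub>R J i p)"
    by (subst (2) u) (simp add: inner_simps)
  also have "inner u h = inner h h"
    by (subst u) (simp add: inner_simps inner_sum_left inner_commute[of "J _ p" h] hJ)
  finally have "inner u u = inner h h + (\<Sum>i\<in>UNIV. inner u (J i p) * inner u (J i p))"
    by (simp add: inner_sum_right)
  then have eq: "metric p u u = inner h h + (\<Sum>i\<in>UNIV. x i * (inner u (J i p))\<^sup>2)"
    unfolding metric_def sum_3 by (simp add: t_def power2_eq_square algebra_simps)
  have nn: "0 \<le> x i * (inner u (J i p))\<^sup>2" for i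
    using x_pos[of i] by simp
  have "metric p u u \<ge> 0"
    unfolding eq using nn by (intro add_nonneg_nonneg sum_nonneg) auto
  moreover have "metric p u u \<noteq> 0"
  proof
    assume "metric p u u = 0"
    then have "inner h h = 0" and s: "(\<Sum>i\<in>UNIV. x i * (inner u (J i p))\<^sup>2) = 0"
      unfolding eq using nn by (auto simp: add_nonneg_eq_0_iff sum_nonneg)
    have "inner u (J i p) = 0" for i
      using s x_pos[of i] nn by (simp add: sum_nonneg_eq_0_iff) (metis less_irrefl)
    then have "u = 0" using \<open>inner h h = 0\<close> u by simp
    with assms show False by simp
  qed
  ultimately show ?thesis by simp
qed

lemmas smooth_J = smooth_on_sphere_linear[OF bounded_linear_J]

lemmas sphere_deriv_J = sphere_deriv_linear[OF bounded_linear_J]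

lemma riemannian_metric: "riemannian_metric metric"
  unfolding riemannian_metric_def
proof (intro conjI ballI allI impI)
  fix X Y :: "'a \<Rightarrow> 'a"
  assume XY: "vector_field X" "vector_field Y"
  then show "smooth_on_sphere (\<lambda>p. metric p (X p) (Y p))"
    unfolding metric_def vector_field_def
    by (intro smooth_on_sphere_intros smooth_on_sphere_sum smooth_J finite) auto
qed (auto simp: metric_add metric_scale metric_pos intro: metric_commute)

lemma smooth_diff_tensor:
  assumes "smooth_on_sphere A" "smooth_on_sphere B"
  shows "smooth_on_sphere (\<lambda>q. diff_tensor q (A q) (B q))"
  unfolding diff_tensor_def
  by (intro smooth_on_sphere_intros smooth_on_sphere_sum smooth_J finite assms)

lemma vector_field_conn:
  assumes X: "vector_field X" and Y: "vector_field Y"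
  shows "vector_field (conn X Y)"
proof -
  have s: "smooth_on_sphere X" "smooth_on_sphere Y"
    using assms by (simp_all add: vector_field_def)
  have "smooth_on_sphere (conn X Y)"
    unfolding conn_def
    by (intro smooth_on_sphere_intros smooth_on_sphere_deriv smooth_diff_tensor s)
  moreover have "conn X Y p \<in> sphere_tangent p" if p: "p \<in> sphere 0 1" for p
  proof -
    have tan: "X p \<in> sphere_tangent p" "Y p \<in> sphere_tangent p"
      using X Y p by (auto simp: vector_field_def)
    have "inner p (diff_tensor p (X p) (Y p)) = 0"
      using diff_tensor_tangent[OF p tan] by (simp add: sphere_tangent_def)
    moreover have "inner p p = 1" using p by (simp add: norm_eq_1)
    ultimately show ?thesis
      using inner_sphere_deriv[OF Y p tan(1)] by (simp add: conn_def sphere_tangent_def inner_simps)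
  qed
  ultimately show ?thesis by (simp add: vector_field_def)
qed

lemma affine_connection_conn: "affine_connection conn"
  unfolding affine_connection_def
proof (intro conjI allI impI ballI)
  fix X Y Z :: "'a \<Rightarrow> 'a" and f :: "'a \<Rightarrow> real" and p :: 'a
  assume X: "vector_field X" and Y: "vector_field Y" and Z: "vector_field Z"
    and f: "smooth_on_sphere f" and p: "p \<in> sphere 0 1"
  have s: "smooth_on_sphere X" "smooth_on_sphere Y" "smooth_on_sphere Z"
    using X Y Z by (simp_all add: vector_field_def)
  have l: "sphere_deriv Z p (u + v) = sphere_deriv Z p u + sphere_deriv Z p v"
    "sphere_deriv Z p (r *\<^sub>R u) = r *\<^sub>R sphere_deriv Z p u" for u v r
    using linear_sphere_deriv[OF s(3) p] by (simp_all add: linear_add linear_cmul)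
  show "conn (\<lambda>q. X q + Y q) Z p = conn X Z p + conn Y Z p"
    unfolding conn_def l diff_tensor_linear by (simp add: inner_simps algebra_simps)
  show "conn (\<lambda>q. f q *\<^sub>R X q) Z p = f p *\<^sub>R conn X Z p"
    unfolding conn_def l diff_tensor_linear by (simp add: inner_simps algebra_simps)
  show "conn X (\<lambda>q. Y q + Z q) p = conn X Y p + conn X Z p"
    unfolding conn_def diff_tensor_linear sphere_deriv_add[OF s(2,3) p]
    by (simp add: inner_simps algebra_simps)
  show "conn X (\<lambda>q. f q *\<^sub>R Y q) p = sphere_deriv f p (X p) *\<^sub>R Y p + f p *\<^sub>R conn X Y p"
    unfolding conn_def diff_tensor_linear sphere_deriv_bilinear[OF bounded_bilinear_scaleR f s(2) p]
    by (simp add: inner_simps algebra_simps)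
qed (simp add: vector_field_conn)

text \<open>Torsion vanishes because \<open>diff_tensor\<close> is symmetric. For compatibility, the
  derivative of \<open>J i\<close> along \<open>u\<close> is \<open>J i u\<close>; the resulting
  terms are the two instances of \<open>metric_diff_tensor\<close>, in which
  \<open>inner (J i y) z\<close> and \<open>inner (J i z) y\<close> cancel by skewness.\<close>

lemma is_levi_civita_conn: "is_levi_civita metric conn"
  unfolding is_levi_civita_def
proof (intro conjI allI impI ballI)
  fix X Y Z :: "'a \<Rightarrow> 'a" and p :: 'a
  assume X: "vector_field X" and Y: "vector_field Y" and Z: "vector_field Z"
    and p: "p \<in> sphere 0 1"
  have s: "smooth_on_sphere X" "smooth_on_sphere Y" "smooth_on_sphere Z"
    and tan: "X p \<in> sphere_tangent p" "Y p \<in> sphere_tangent p" "Z p \<in> sphere_tangent p"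
    using X Y Z p by (simp_all add: vector_field_def)
  show "conn X Y p - conn Y X p = vf_bracket X Y p"
    by (simp add: conn_def vf_bracket_def diff_tensor_commute inner_commute)
  define u y z y' z' where "u = X p" and "y = Y p" and "z = Z p"
    and "y' = sphere_deriv Y p u" and "z' = sphere_deriv Z p u"
  have sJ: "smooth_on_sphere (J i)" for i
    using smooth_J[OF smooth_on_sphere_ident] .
  have dJ: "sphere_deriv (J i) p u = J i u" for i
    using sphere_deriv_J[OF smooth_on_sphere_ident p, of i u] sphere_deriv_ident[OF p tan(1)]
    by (simp add: u_def)
  have "sphere_deriv (\<lambda>q. metric q (Y q) (Z q)) p u = inner y z' + inner y' z
    + (\<Sum>i\<in>UNIV. t i * (inner y (J i p) * (inner z (J i u) + inner z' (J i p))
         + (inner y (J i u) + inner y' (J i p)) * inner z (J i p)))"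
    unfolding metric_def sum_3 y_def z_def y'_def z'_def
    using p by (simp add: sphere_deriv_rules smooth_on_sphere_intros s sJ dJ)
  moreover have "metric p (a + r *\<^sub>R p + v) w = metric p a w + metric p v w"
    if "w \<in> sphere_tangent p" for a r v w
    unfolding metric_add metric_scale
    using that by (simp add: metric_def sphere_tangent_def)
  then have "metric p (conn X Y p) z = metric p y' z + metric p (diff_tensor p u y) z"
    "metric p (conn X Z p) y = metric p z' y + metric p (diff_tensor p u z) y"
    unfolding conn_def u_def y_def z_def y'_def z'_def using tan by blast+
  ultimately show "sphere_deriv (\<lambda>q. metric q (Y q) (Z q)) p (X p) =
      metric p (conn X Y p) (Z p) + metric p (Y p) (conn X Z p)"
    using metric_diff_tensor[OF p tan(1,2,3)] metric_diff_tensor[OF p tan(1,3,2)]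
    unfolding metric_commute[of p "Y p"]
    unfolding u_def[symmetric] y_def[symmetric] z_def[symmetric]
    by (simp add: metric_def sum_3 inner_commute[of z' y] inner_commute[of z "J _ u"]
       inner_commute[of z "J _ y"] inner_commute[of y "J _ u"] J_skew[of _ z y] algebra_simps)
qed (simp add: affine_connection_conn)

lemma levi_civita_metric: "is_levi_civita metric (levi_civita metric)"
  by (rule is_levi_civita_levi_civita[OF is_levi_civita_conn])

lemma levi_civita_eq_conn:
  assumes "vector_field X" "vector_field Y" "p \<in> sphere 0 1"
  shows "levi_civita metric X Y p = conn X Y p"
  by (rule levi_civita_unique[OF riemannian_metric levi_civita_metric is_levi_civita_conn assms])

section \<open>The curvature tensor\<close>

lemma vector_field_levi_civita:
  "vector_field X \<Longrightarrow> vector_field Y \<Longrightarrow> vector_field (levi_civita metric X Y)"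
  using levi_civita_metric by (simp add: is_levi_civita_def affine_connection_def)

text \<open>Since \<open>conn\<close> has no torsion, the bracket is a difference of two covariant
  derivatives and inherits smoothness and tangency from them.\<close>

lemma vector_field_bracket:
  fixes X Y :: "'a \<Rightarrow> 'a"
  assumes "vector_field X" "vector_field Y"
  shows "vector_field (vf_bracket X Y)"
proof (rule vector_field_cong)
  show "vector_field (\<lambda>q. conn X Y q - conn Y X q)"
    using assms by (intro vector_field_diff vector_field_conn)
  show "conn X Y q - conn Y X q = vf_bracket X Y q" for q
    by (simp add: conn_def vf_bracket_def diff_tensor_commute inner_commute)
qed

text \<open>The derivative of \<^term>\<open>diff_tensor\<close> in the base point \<open>p\<close>, in the direction \<open>w\<close>.\<close>

definition diff_tensor' :: "'a \<Rightarrow> 'a \<Rightarrow> 'a \<Rightarrow> 'a \<Rightarrow> 'a" where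
  "diff_tensor' p w u v = (\<Sum>i\<in>UNIV.
     t i *\<^sub>R (inner v (J i w) *\<^sub>R J i u + inner u (J i w) *\<^sub>R J i v
       + (2 * (inner u (J i w) * inner v (J i p) + inner u (J i p) * inner v (J i w))) *\<^sub>R p
       + (2 * (inner u (J i p) * inner v (J i p))) *\<^sub>R w)
     - (c i * (inner u (J (i + 1) w) * inner v (J (i + 2) p)
         + inner u (J (i + 1) p) * inner v (J (i + 2) w)
         + inner u (J (i + 2) w) * inner v (J (i + 1) p)
         + inner u (J (i + 2) p) * inner v (J (i + 1) w))) *\<^sub>R J i p
     - (c i * (inner u (J (i + 1) p) * inner v (J (i + 2) p)
         + inner u (J (i + 2) p) * inner v (J (i + 1) p))) *\<^sub>R J i w)"

lemma sphere_deriv_diff_tensor: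
  assumes A: "smooth_on_sphere A" and B: "smooth_on_sphere B"
    and p: "p \<in> sphere 0 1" and w: "w \<in> sphere_tangent p"
  shows "sphere_deriv (\<lambda>q. diff_tensor q (A q) (B q)) p w = diff_tensor' p w (A p) (B p)
    + diff_tensor p (sphere_deriv A p w) (B p) + diff_tensor p (A p) (sphere_deriv B p w)"
proof -
  have sJ: "smooth_on_sphere (J i)" for i
    using smooth_J[OF smooth_on_sphere_ident] .
  have dJ: "sphere_deriv (J i) p w = J i w" for i
    using sphere_deriv_J[OF smooth_on_sphere_ident p, of i w] sphere_deriv_ident[OF p w] by simp
  show ?thesis
    unfolding diff_tensor_def diff_tensor'_def sum.distrib[symmetric]
    by (subst sphere_deriv_sum[OF finite p], (intro smooth_on_sphere_intros smooth_J A B)[1],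
        intro sum.cong refl)
      (use p w in \<open>simp add: sphere_deriv_rules smooth_on_sphere_intros smooth_J A B sJ dJ
        sphere_deriv_J sphere_deriv_ident inner_simps J_simps algebra_simps\<close>)
qed

text \<open>Needed at all \<open>q\<close> of the sphere, as it is differentiated once more. The
  last term vanishes at a point where \<open>v\<close> is tangent, but its derivative there produces
  the curvature of the round sphere.\<close>

lemma conn_tangent_ext:
  assumes q: "q \<in> sphere 0 1"
  shows "conn (tangent_ext u) (tangent_ext v) q =
    diff_tensor q (tangent_ext u q) (tangent_ext v q) - inner q v *\<^sub>R tangent_ext u q"
proof -
  have "inner (tangent_ext u q) (tangent_ext v q) = inner (tangent_ext u q) v"
    using tangent_ext_in[OF q, of u]
    by (simp add: tangent_ext_def[of v] inner_simps sphere_tangent_def inner_commute)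
  then show ?thesis
    by (simp add: conn_def sphere_deriv_tangent_ext[OF q tangent_ext_in[OF q]])
qed

text \<open>The derivative of \<open>tangent_ext u\<close> at \<open>p\<close> along
  \<open>w\<close> is \<open>- inner w u *\<^sub>R p\<close>, which is why
  \<open>diff_tensor\<close> is also evaluated on the normal vector \<open>p\<close>.\<close>

lemma conn_conn_tangent_ext:
  assumes p: "p \<in> sphere 0 1"
    and u: "u \<in> sphere_tangent p" and v: "v \<in> sphere_tangent p" and w: "w \<in> sphere_tangent p"
  shows "levi_civita metric (tangent_ext w) (levi_civita metric (tangent_ext u) (tangent_ext v)) p =
    diff_tensor' p w u v - inner w u *\<^sub>R diff_tensor p p v - inner w v *\<^sub>R diff_tensor p u p
    - inner w v *\<^sub>R u + inner w (diff_tensor p u v) *\<^sub>R p + diff_tensor p w (diff_tensor p u v)"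
proof -
  let ?F = "\<lambda>q. diff_tensor q (tangent_ext u q) (tangent_ext v q) - inner q v *\<^sub>R tangent_ext u q"
  have s: "smooth_on_sphere (tangent_ext u)" for u :: 'a
    using vector_field_tangent_ext vector_field_def by blast
  have sF: "smooth_on_sphere ?F"
    by (intro smooth_on_sphere_intros smooth_diff_tensor s)
  have eq: "?F q = levi_civita metric (tangent_ext u) (tangent_ext v) q" if "q \<in> sphere 0 1" for q
    using that by (simp add: levi_civita_eq_conn vector_field_tangent_ext conn_tangent_ext)
  have pv: "inner p u = 0" "inner p v = 0" using u v by (simp_all add: sphere_tangent_def)
  have Fp: "?F p = diff_tensor p u v"
    using pv by (simp add: tangent_ext_tangent u v)
  have e: "sphere_deriv (tangent_ext z) p w = - inner w z *\<^sub>R p" if "inner p z = 0" for z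
    using that by (simp add: sphere_deriv_tangent_ext[OF p w])
  have "sphere_deriv ?F p w =
    sphere_deriv (\<lambda>q. diff_tensor q (tangent_ext u q) (tangent_ext v q)) p w - inner w v *\<^sub>R u"
    using p w by (simp add: sphere_deriv_rules smooth_on_sphere_intros smooth_diff_tensor s
        sphere_deriv_ident tangent_ext_tangent u v pv)
  then have dF: "sphere_deriv ?F p w = diff_tensor' p w u v - inner w u *\<^sub>R diff_tensor p p v
      - inner w v *\<^sub>R diff_tensor p u p - inner w v *\<^sub>R u"
    unfolding sphere_deriv_diff_tensor[OF s s p w] e[OF pv(1)] e[OF pv(2)]
    unfolding diff_tensor_linear by (simp add: tangent_ext_tangent u v)
  \<comment> \<open>The chosen connection is known only on the sphere, which suffices because
    \<open>sphere_deriv\<close> depends only on values there.\<close>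
  have dL: "sphere_deriv (levi_civita metric (tangent_ext u) (tangent_ext v)) p w = sphere_deriv ?F p w"
    by (rule sphere_deriv_cong[OF sF p]) (rule eq)
  have "levi_civita metric (tangent_ext w) (levi_civita metric (tangent_ext u) (tangent_ext v)) p =
    conn (tangent_ext w) (levi_civita metric (tangent_ext u) (tangent_ext v)) p"
    by (intro levi_civita_eq_conn vector_field_levi_civita vector_field_tangent_ext p)
  also have "\<dots> = sphere_deriv ?F p w + inner w (?F p) *\<^sub>R p + diff_tensor p w (?F p)"
    unfolding conn_def tangent_ext_tangent[OF w] dL eq[OF p, symmetric] ..
  finally show ?thesis unfolding dF Fp .
qed

lemma curvature_metric:
  assumes p: "p \<in> sphere 0 1"
    and u: "u \<in> sphere_tangent p" and v: "v \<in> sphere_tangent p" and w: "w \<in> sphere_tangent p"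
  shows "curvature metric (tangent_ext w) (tangent_ext u) (tangent_ext v) p =
    inner u v *\<^sub>R w - inner w v *\<^sub>R u + diff_tensor' p w u v - diff_tensor' p u w v
    + inner u v *\<^sub>R diff_tensor p w p - inner w v *\<^sub>R diff_tensor p u p
    + (inner w (diff_tensor p u v) - inner u (diff_tensor p w v)) *\<^sub>R p
    + diff_tensor p w (diff_tensor p u v) - diff_tensor p u (diff_tensor p w v)"
proof -
  \<comment> \<open>Both derivatives equal \<open>- inner u w *\<^sub>R p\<close>. The bracket
    vanishes at \<open>p\<close> only, which is enough because \<open>conn\<close> depends on its
    first argument pointwise.\<close>
  have "vf_bracket (tangent_ext w) (tangent_ext u) p = 0"
    using u w unfolding vf_bracket_def tangent_ext_tangent[OF u] tangent_ext_tangent[OF w]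
      sphere_deriv_tangent_ext[OF p u] sphere_deriv_tangent_ext[OF p w]
    by (simp add: sphere_tangent_def inner_commute)
  moreover have "diff_tensor p 0 v = 0" using diff_tensor_linear(3)[of p 0 0 v] by simp
  moreover have "sphere_deriv (tangent_ext v) p 0 = 0"
    using linear_sphere_deriv[OF _ p] vector_field_tangent_ext linear_0 vector_field_def by blast
  ultimately have "levi_civita metric (vf_bracket (tangent_ext w) (tangent_ext u)) (tangent_ext v) p = 0"
    unfolding levi_civita_eq_conn[OF vector_field_bracket[OF vector_field_tangent_ext vector_field_tangent_ext]
        vector_field_tangent_ext p]
    by (simp add: conn_def tangent_ext_tangent v)
  then show ?thesis
    unfolding curvature_def Let_def conn_conn_tangent_ext[OF p u v w] conn_conn_tangent_ext[OF p w v u]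
    by (simp add: inner_commute algebra_simps)
qed

lemma curvature_tangent:
  assumes "p \<in> sphere 0 1" "vector_field X" "vector_field Y" "vector_field Z"
  shows "curvature metric X Y Z p \<in> sphere_tangent p"
proof -
  have "vector_field (\<lambda>q. levi_civita metric X (levi_civita metric Y Z) q
      - levi_civita metric Y (levi_civita metric X Z) q - levi_civita metric (vf_bracket X Y) Z q)"
    using assms by (intro vector_field_diff vector_field_levi_civita vector_field_bracket)
  then show ?thesis
    using assms(1) by (simp add: vector_field_def curvature_def Let_def)
qed

section \<open>Traces and the Ricci tensor\<close>

lemma tangent_trace_J: "tangent_trace p (J i) = 0"
  by (rule tangent_trace_skew) (rule J_skew)

lemmas trace_rules = tangent_trace_add tangent_trace_diff tangent_trace_scale tangent_trace_minus
  tangent_trace_rank_one linear_scalar_rules linear_J tangent_trace_J J_table inner_simps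
  J_skew

text \<open>Each summand is a multiple of \<open>w\<close> or of \<open>J i w\<close>, or has rank
  one in \<open>w\<close>. The dimension enters through the multiples of \<open>w\<close>
  alone.\<close>

lemma tangent_trace_diff_tensor':
  assumes p: "p \<in> sphere 0 1" and u: "u \<in> sphere_tangent p" and v: "v \<in> sphere_tangent p"
  shows "tangent_trace p (\<lambda>w. diff_tensor' p w u v) = (\<Sum>i\<in>UNIV.
    2 * t i * (DIM('a) * (inner u (J i p) * inner v (J i p)) - inner u v)
    + 2 * c i * (inner u (J (i + 1) p) * inner v (J (i + 1) p) - inner u (J (i + 2) p) * inner v (J (i + 2) p)))"
proof -
  have uv: "inner u p = 0" "inner v p = 0" "inner p p = 1"
    using p u v by (simp_all add: sphere_tangent_def inner_commute norm_eq_1)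
  show ?thesis
    unfolding diff_tensor'_def tangent_trace_sum sum_3 three_add
    by (simp add: trace_rules tangent_trace_ident[OF p] uv scaleR_add_left scaleR_add_right)
      (simp add: algebra_simps inner_commute[of v u])
qed

lemma tangent_trace_diff_tensor'_snd:
  assumes p: "p \<in> sphere 0 1" and u: "u \<in> sphere_tangent p" and v: "v \<in> sphere_tangent p"
  shows "tangent_trace p (\<lambda>w. diff_tensor' p u w v) =
    (\<Sum>i\<in>UNIV. t i * (inner u (J i p) * inner v (J i p) + inner u v))"
proof -
  have uv: "inner u p = 0" "inner v p = 0" "inner p p = 1"
    using p u v by (simp_all add: sphere_tangent_def inner_commute norm_eq_1)
  show ?thesis
    unfolding diff_tensor'_def tangent_trace_sum sum_3 three_add
    by (simp add: trace_rules tangent_trace_ident[OF p] uv scaleR_add_left scaleR_add_right)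
      (simp add: algebra_simps inner_commute[of v u] inner_commute[of p "J _ u"] J_skew)
qed

text \<open>\<open>v\<close> is not restricted to tangent vectors: the Ricci trace uses both
  \<open>v = p\<close> and a tangent value, for which the sum vanishes.\<close>

lemma tangent_trace_diff_tensor:
  assumes p: "p \<in> sphere 0 1"
  shows "tangent_trace p (\<lambda>w. diff_tensor p w v) = (\<Sum>i\<in>UNIV. t i * inner v p)"
proof -
  have uv: "inner p p = 1"
    using p by (simp_all add: sphere_tangent_def inner_commute norm_eq_1)
  show ?thesis
    unfolding diff_tensor_def tangent_trace_sum sum_3 three_add
    by (simp add: trace_rules tangent_trace_ident[OF p] uv scaleR_add_left scaleR_add_right
      inner_commute[of p v] algebra_simps)
qed

text \<open>Beyond rank-one terms, the composition contains only the products
  \<open>J i (J j w)\<close>. For distinct indices they are traceless, being another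
  \<open>J k w\<close> up to sign; for equal ones they are \<open>- w\<close> and bring in the
  dimension.\<close>

lemma tangent_trace_diff_tensor_comp:
  assumes p: "p \<in> sphere 0 1" and u: "u \<in> sphere_tangent p" and v: "v \<in> sphere_tangent p"
  shows "tangent_trace p (\<lambda>w. diff_tensor p u (diff_tensor p w v)) =
    (\<Sum>i\<in>UNIV. inner u (J i p) * inner v (J i p) *
      (2 * t i * (t (i + 1) + t (i + 2) + c (i + 1) - c (i + 2)) - (real DIM('a) - 2) * (t i)\<^sup>2
        - 2 * (t (i + 1) - c (i + 2)) * (t (i + 2) + c (i + 1))))"
proof -
  have uv: "inner u p = 0" "inner v p = 0" "inner p p = 1"
    using p u v by (simp_all add: sphere_tangent_def inner_commute norm_eq_1)
  show ?thesis
    unfolding diff_tensor_def tangent_trace_sum sum_3 three_add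
    by (simp add: trace_rules J_simps tangent_trace_ident[OF p] uv scaleR_add_left scaleR_add_right)
      (simp add: trace_rules uv algebra_simps power2_eq_square inner_commute[of v u])
qed

lemma ricci_metric:
  assumes p: "p \<in> sphere 0 1" and u: "u \<in> sphere_tangent p" and v: "v \<in> sphere_tangent p"
  shows "ricci metric p u v = (real DIM('a) - 2 - 2 * (\<Sum>i\<in>UNIV. t i)) * inner u v
    + (\<Sum>i\<in>UNIV. inner u (J i p) * inner v (J i p) *
      ((2 * real DIM('a) - 2) * t i - 2 * (c (i + 1) - c (i + 2)) + (real DIM('a) - 2) * (t i)\<^sup>2
        - 2 * t i * (t (i + 1) + t (i + 2) + c (i + 1) - c (i + 2))
        + 2 * (t (i + 1) - c (i + 2)) * (t (i + 2) + c (i + 1))))"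
proof -
  let ?s = "diff_tensor p u v"
  \<comment> \<open>The right-hand side of \<open>curvature_metric\<close>, read as a map that is
    linear in every ambient \<open>w\<close>, as the trace formula requires.\<close>
  define L where "L w = inner u v *\<^sub>R w - inner w v *\<^sub>R u + diff_tensor' p w u v - diff_tensor' p u w v
    + inner u v *\<^sub>R diff_tensor p w p - inner w v *\<^sub>R diff_tensor p u p
    + (inner w ?s - inner u (diff_tensor p w v)) *\<^sub>R p
    + diff_tensor p w ?s - diff_tensor p u (diff_tensor p w v)" for w
  have lin: "linear (\<lambda>w. diff_tensor' p w u v)" "linear (\<lambda>w. diff_tensor' p u w v)"
    "linear (\<lambda>w. diff_tensor p w z)" for z
    by (auto intro!: linearI simp: diff_tensor_linear)
      (auto simp: diff_tensor'_def sum_3 J_simps inner_simps algebra_simps)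
  have "linear L"
    unfolding L_def
    by (rule linearI) (simp_all add: linear_add[OF lin(1)] linear_add[OF lin(2)] linear_cmul[OF lin(1)]
      linear_cmul[OF lin(2)] diff_tensor_linear inner_simps algebra_simps)
  moreover have "curvature metric (tangent_ext w) (tangent_ext u) (tangent_ext v) p = L w"
    if "w \<in> sphere_tangent p" for w
    unfolding L_def by (rule curvature_metric[OF p u v that])
  ultimately have "ricci metric p u v = tangent_trace p L"
    unfolding ricci_def
    by (intro trace_on_sphere_tangent p curvature_tangent vector_field_tangent_ext) auto
  also have "\<dots> = inner u v * (real DIM('a) - 1) - inner u v
    + tangent_trace p (\<lambda>w. diff_tensor' p w u v) - tangent_trace p (\<lambda>w. diff_tensor' p u w v)
    + inner u v * tangent_trace p (\<lambda>w. diff_tensor p w p) - inner v (diff_tensor p u p)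
    + tangent_trace p (\<lambda>w. diff_tensor p w ?s)
    - tangent_trace p (\<lambda>w. diff_tensor p u (diff_tensor p w v))"
  proof -
    have l: "linear (\<lambda>w. inner w ?s - inner u (diff_tensor p w v))"
      by (intro linear_scalar_rules lin)
    have "inner p p = 1" "inner p v = 0" using p v by (simp_all add: sphere_tangent_def norm_eq_1)
    then have "tangent_trace p (\<lambda>w. (inner w ?s - inner u (diff_tensor p w v)) *\<^sub>R p) = 0"
      "tangent_trace p (\<lambda>w. inner w v *\<^sub>R z) = inner v z" for z
      using tangent_trace_rank_one[OF l, of p p] tangent_trace_rank_one[OF linear_scalar_rules(6), of p v z]
      by (simp_all add: inner_commute)
    then show ?thesis
      unfolding L_def tangent_trace_add tangent_trace_diff tangent_trace_scale tangent_trace_ident[OF p]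
      by (simp add: inner_commute)
  qed
  also have "inner v (diff_tensor p u p) = (\<Sum>i\<in>UNIV. t i * (inner u (J i p) * inner v (J i p)))"
    unfolding diff_tensor_def inner_sum_right by (simp add: inner_simps mult.assoc)
  also have "tangent_trace p (\<lambda>w. diff_tensor p w ?s) = 0"
    using diff_tensor_tangent[OF p u v] tangent_trace_diff_tensor[OF p, of ?s]
    by (simp add: sphere_tangent_def inner_commute)
  also have "tangent_trace p (\<lambda>w. diff_tensor p w p) = (\<Sum>i\<in>UNIV. t i)"
    using tangent_trace_diff_tensor[OF p, of p] p by (simp add: norm_eq_1)
  finally show ?thesis
    unfolding tangent_trace_diff_tensor'[OF p u v] tangent_trace_diff_tensor'_snd[OF p u v]
      tangent_trace_diff_tensor_comp[OF p u v] sum_3 three_add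
    by (simp add: algebra_simps power2_eq_square)
qed

text \<open>\<open>X\<close>, \<open>Y\<close>, \<open>Z\<close> stand for \<open>x i\<close>,
  \<open>x (i + 1)\<close>, \<open>x (i + 2)\<close>, the constants \<open>c1\<close>,
  \<open>c2\<close> for \<open>c (i + 1)\<close>, \<open>c (i + 2)\<close>, and \<open>N\<close> for
  the ambient dimension. The horizontal coefficient is subtracted because \<open>inner u v\<close>
  in \<open>ricci_metric\<close> also counts the vertical part.\<close>

lemma ricci_coefficient:
  fixes X Y Z N :: real
  assumes "X > 0" "Y > 0" "Z > 0"
  defines "c1 \<equiv> (Y - 1) / Y * (X - Z)" and "c2 \<equiv> (Z - 1) / Z * (Y - X)"
  shows "(2 * N - 2) * (X - 1) - 2 * (c1 - c2) + (N - 2) * (X - 1)\<^sup>2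
      - 2 * (X - 1) * (Y - 1 + (Z - 1) + c1 - c2) + 2 * (Y - 1 - c2) * (Z - 1 + c1)
    = 2 * (X\<^sup>2 - (Y - Z)\<^sup>2) / (Y * Z) + (N - 4) * X\<^sup>2 - (N + 4 - 2 * (X + Y + Z))"
  unfolding c1_def c2_def using assms(1-3) by (simp add: divide_simps) algebra

lemma ricci_metric_eq:
  assumes p: "p \<in> sphere 0 1" and u: "u \<in> sphere_tangent p" and v: "v \<in> sphere_tangent p"
  shows "ricci metric p u v =
    (real DIM('a) + 4 - 2 * (\<Sum>i\<in>UNIV. x i)) *
      (inner u v - (\<Sum>i\<in>UNIV. inner u (J i p) * inner v (J i p)))
    + (\<Sum>i\<in>UNIV. (2 * ((x i)\<^sup>2 - (x (i + 1) - x (i + 2))\<^sup>2) / (x (i + 1) * x (i + 2))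
      + (real DIM('a) - 4) * (x i)\<^sup>2) * (inner u (J i p) * inner v (J i p)))"
proof -
  have c: "c 1 = (x 1 - 1) / x 1 * (x 3 - x 2)" "c 2 = (x 2 - 1) / x 2 * (x 1 - x 3)"
    "c 3 = (x 3 - 1) / x 3 * (x 2 - x 1)"
    unfolding c_def t_def three_add by simp_all
  have *: "a + (y1 * A1 + y2 * A2 + y3 * A3) = b * (z - (y1 + y2 + y3)) + (B1 * y1 + B2 * y2 + B3 * y3)"
    if "a = b * z" "A1 = B1 - b" "A2 = B2 - b" "A3 = B3 - b"
    for a b z y1 y2 y3 A1 A2 A3 B1 B2 B3 :: real
    unfolding that by (simp add: algebra_simps)
  show ?thesis
    unfolding ricci_metric[OF assms] sum_3 three_add c t_def
    using ricci_coefficient[OF x_pos[of 1] x_pos[of 2] x_pos[of 3], of "real DIM('a)"]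
      ricci_coefficient[OF x_pos[of 2] x_pos[of 3] x_pos[of 1], of "real DIM('a)"]
      ricci_coefficient[OF x_pos[of 3] x_pos[of 1] x_pos[of 2], of "real DIM('a)"]
    by (intro *) (simp_all only: add.assoc add.commute add.left_commute, simp_all)
qed

end

section \<open>Maximizing the scalar curvature\<close>

text \<open>The scalar curvature in terms of the inverses \<open>p\<close>, \<open>q\<close>, \<open>r\<close>, \<open>z\<close> of the metric parameters
  \<open>x\<^sub>1\<close>, \<open>x\<^sub>2\<close>, \<open>x\<^sub>3\<close>, \<open>s\<close>.\<close>

definition scalar_curv :: "real \<Rightarrow> real \<Rightarrow> real \<Rightarrow> real \<Rightarrow> real \<Rightarrow> real" where
  "scalar_curv n p q r z = 4 * (p + q + r) - 2 * (q * r / p + p * r / q + p * q / r)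
     + 4 * n * (4 * n + 8) * z - 4 * n * z\<^sup>2 * (1 / p + 1 / q + 1 / r)"

lemma scalar_curv_rotate: "scalar_curv n p q r z = scalar_curv n q r p z"
  by (simp add: scalar_curv_def algebra_simps)

lemma sum_ratio_ge:
  fixes p q r :: real
  assumes "p > 0" "q > 0" "r > 0"
  shows "p * r / q + q * r / p \<ge> 2 * r"
proof -
  have "p * r / q + q * r / p - 2 * r = r * (p - q)\<^sup>2 / (p * q)"
    using assms by (simp add: field_simps power2_eq_square)
  moreover have "r * (p - q)\<^sup>2 / (p * q) \<ge> 0" using assms by simp
  ultimately show ?thesis by linarith
qed

text \<open>Each quotient occurs in two of the three instances of \<open>sum_ratio_ge\<close>, so
  their sum is at least \<open>p + q + r\<close>.\<close>

lemma scalar_curv_zero_le: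
  assumes "p > 0" "q > 0" "r > 0"
  shows "scalar_curv n p q r 0 \<le> 2 * (p + q + r)"
  using sum_ratio_ge[of p q r] sum_ratio_ge[of q r p] sum_ratio_ge[of r p q] assms
  by (simp add: scalar_curv_def mult.commute)

text \<open>A quantitative form of the boundary behavior, with no upper bound on \<open>z\<close>.
  The fiber part and the part depending on \<open>z\<close> are each kept to at most
  \<open>m / 2\<close>, the former strictly.\<close>

lemma scalar_curv_small:
  assumes pos: "p > 0" "q > 0" "r > 0" and z: "z \<ge> 0" and n: "n > 0" and m: "m > 0"
    and le: "q \<le> M" "r \<le> M" and \<delta>: "p \<le> \<delta>"
    and d1: "\<delta> < m / 16" and d2: "\<delta> * M \<le> (m / 16)\<^sup>2 / 4" and d3: "2 * n * (4 * n + 8)\<^sup>2 * \<delta> \<le> m"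
  shows "scalar_curv n p q r z < m"
proof -
  \<comment> \<open>If the smaller variable \<open>q\<close> is below \<open>m / 16\<close>, the
    quotients absorb \<open>4 * r\<close> and leave at most \<open>4 * (p + q)\<close>. Otherwise
    \<open>q * r / p\<close> is at least \<open>4 * M\<close> and outweighs everything.\<close>
  have aux: "4 * (p + q + r) - 2 * (q * r / p + p * r / q + p * q / r) < m / 2"
    if "0 < q" "0 < r" "q \<le> r" "r \<le> M" for q r
  proof (cases "q < m / 16")
    case True
    have "p * q / r > 0" using pos that by simp
    moreover have "4 * (p + q + r) - 2 * (A + B + C) < m / 2" if "B + A \<ge> 2 * r" "C > 0" for A B C
      using that True d1 \<delta> by argo
    ultimately show ?thesis using sum_ratio_ge[OF pos(1) that(1,2)] by blast
  next
    case False
    have M: "M > 0" using that by linarith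
    have "p * M \<le> (m / 16)\<^sup>2 / 4"
      using d2 mult_right_mono[OF \<delta>, of M] M by linarith
    also have "(m / 16)\<^sup>2 \<le> q * r"
      unfolding power2_eq_square using False that m by (intro mult_mono) auto
    finally have "4 * M \<le> q * r / p" using pos by (simp add: field_simps)
    moreover have "p * r / q + p * q / r \<ge> 2 * p"
      using sum_ratio_ge[of r q p] that pos by (simp add: mult.commute)
    ultimately show ?thesis using that m by simp
  qed
  have "4 * (p + q + r) - 2 * (q * r / p + p * r / q + p * q / r) < m / 2"
  proof (cases "q \<le> r")
    case True
    then show ?thesis using aux[of q r] pos le by simp
  next
    case False
    then show ?thesis using aux[of r q] pos le by (simp add: algebra_simps)
  qed
  \<comment> \<open>Completing the square in \<open>z\<close> bounds
    \<open>k * z - z\<^sup>2 / p\<close> by a multiple of \<open>p\<close>; the remaining terms are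
    nonpositive.\<close>
  moreover have "4 * n * (4 * n + 8) * z - 4 * n * z\<^sup>2 * (1 / p + 1 / q + 1 / r) \<le> m / 2"
  proof -
    define k where "k = 4 * n + 8"
    have "k * z - z\<^sup>2 / p \<le> k\<^sup>2 * p / 4"
    proof -
      have "k\<^sup>2 * p / 4 - (k * z - z\<^sup>2 / p) = (z - k * p / 2)\<^sup>2 / p"
        using pos by (simp add: field_simps power2_eq_square)
      also have "\<dots> \<ge> 0" using pos by simp
      finally show ?thesis by simp
    qed
    also have "\<dots> \<le> k\<^sup>2 * \<delta> / 4" using \<delta> by (simp add: mult_left_mono)
    finally have "4 * n * (k * z - z\<^sup>2 / p) \<le> 4 * n * (k\<^sup>2 * \<delta> / 4)"
      using n by (intro mult_left_mono) auto
    also have "\<dots> \<le> m / 2" using d3 by (simp add: k_def)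
    finally have "4 * n * (k * z - z\<^sup>2 / p) \<le> m / 2" .
    moreover have "0 \<le> 4 * n * z\<^sup>2 * (1 / q + 1 / r)" using n pos by simp
    moreover have "4 * n * (4 * n + 8) * z - 4 * n * z\<^sup>2 * (1 / p + 1 / q + 1 / r)
        = 4 * n * (k * z - z\<^sup>2 / p) - 4 * n * z\<^sup>2 * (1 / q + 1 / r)"
      by (simp add: k_def algebra_simps)
    ultimately show ?thesis by argo
  qed
  ultimately show ?thesis unfolding scalar_curv_def by argo
qed

lemma scalar_curv_scale:
  assumes "l > 0" "p > 0" "q > 0" "r > 0"
  shows "scalar_curv n (l * p) (l * q) (l * r) (l * z) = l * scalar_curv n p q r z"
  using assms by (simp add: scalar_curv_def field_simps power2_eq_square)

text \<open>Outside a compact part of the simplex the values stay below the one at a fixed point, so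
  a maximum exists. By homogeneity the last conclusion is stated without the constraint; each
  variable can then be varied alone, and no Lagrange multiplier theorem is called for.\<close>

lemma scalar_curv_max_exists:
  fixes n b a1 a2 a3 :: real
  assumes n: "n > 0" and b: "b > 0" and a: "a1 > 0" "a2 > 0" "a3 > 0"
  obtains p q r z where "p > 0" "q > 0" "r > 0" "z \<ge> 0" "a1 * p + a2 * q + a3 * r + 4 * n * b * z = 1"
    "scalar_curv n p q r z > 0"
    "\<And>p' q' r' z'. p' > 0 \<Longrightarrow> q' > 0 \<Longrightarrow> r' > 0 \<Longrightarrow> z' \<ge> 0 \<Longrightarrow>
       scalar_curv n p' q' r' z' \<le> scalar_curv n p q r z * (a1 * p' + a2 * q' + a3 * r' + 4 * n * b * z')"
proof -
  \<comment> \<open>The comparison point \<open>p = q = r = \<tau>\<close>, \<open>z = 0\<close>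
    satisfies the constraint, and the scalar curvature there is \<open>6 * \<tau>\<close>.\<close>
  define \<tau> where "\<tau> = 1 / (a1 + a2 + a3)"
  define m where "m = 6 * \<tau>"
  define M where "M = 1 / a1 + 1 / a2 + 1 / a3"
  \<comment> \<open>The bound \<open>\<tau>\<close> keeps the comparison point in \<open>K\<close>;
    the other three give the hypotheses of \<open>scalar_curv_small\<close>, with
    \<open>m / 32\<close> for a strict inequality.\<close>
  define \<delta> where "\<delta> = Min {\<tau>, m / 32, (m / 16)\<^sup>2 / 4 / M, m / (2 * n * (4 * n + 8)\<^sup>2)}"
  have \<tau>: "\<tau> > 0" and m: "m > 0" and M: "M > 0" using a by (simp_all add: \<tau>_def m_def M_def add_pos_pos)
  have \<delta>: "\<delta> > 0" "\<delta> \<le> \<tau>" "\<delta> \<le> m / 32" "\<delta> \<le> (m / 16)\<^sup>2 / 4 / M" "\<delta> \<le> m / (2 * n * (4 * n + 8)\<^sup>2)"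
    using \<tau> m M n by (simp_all add: \<delta>_def)
  have d: "\<delta> < m / 16" "\<delta> * M \<le> (m / 16)\<^sup>2 / 4" "2 * n * (4 * n + 8)\<^sup>2 * \<delta> \<le> m"
    using \<delta> m M n by (simp_all add: field_simps)
  \<comment> \<open>The trace of T with respect to g; the horizontal space has dimension 4n.\<close>
  define \<Lambda> where "\<Lambda> p q r z = a1 * p + a2 * q + a3 * r + 4 * n * b * z" for p q r z
  have le: "p \<le> M" "q \<le> M" "r \<le> M" "z \<le> 1 / (4 * n * b)"
    if "p > 0" "q > 0" "r > 0" "z \<ge> 0" "\<Lambda> p q r z = 1" for p q r z
  proof -
    have nn: "a1 * p \<ge> 0" "a2 * q \<ge> 0" "a3 * r \<ge> 0" "4 * n * b * z \<ge> 0"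
      using that a n b by simp_all
    with that have "a1 * p \<le> 1" "a2 * q \<le> 1" "a3 * r \<le> 1" "4 * n * b * z \<le> 1"
      unfolding \<Lambda>_def by linarith+
    then have "p \<le> 1 / a1" "q \<le> 1 / a2" "r \<le> 1 / a3" "z \<le> 1 / (4 * n * b)"
      using a n b by (simp_all add: field_simps)
    moreover have "1 / a1 > 0" "1 / a2 > 0" "1 / a3 > 0" using a by simp_all
    ultimately show "p \<le> M" "q \<le> M" "r \<le> M" "z \<le> 1 / (4 * n * b)" unfolding M_def by linarith+
  qed
  have small: "scalar_curv n p q r z < m"
    if "p > 0" "q > 0" "r > 0" "z \<ge> 0" "\<Lambda> p q r z = 1" "p \<le> \<delta> \<or> q \<le> \<delta> \<or> r \<le> \<delta>" for p q r z
    using that(6)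
  proof (elim disjE)
    assume "p \<le> \<delta>"
    then show ?thesis using scalar_curv_small[of p q r z n m M \<delta>] le[OF that(1-5)] that n m d by simp
  next
    assume "q \<le> \<delta>"
    then show ?thesis using scalar_curv_small[of q r p z n m M \<delta>] le[OF that(1-5)] that n m d
      by (simp add: scalar_curv_rotate[of n p])
  next
    assume "r \<le> \<delta>"
    then show ?thesis using scalar_curv_small[of r p q z n m M \<delta>] le[OF that(1-5)] that n m d
      by (simp add: scalar_curv_rotate[of n r])
  qed
  define K where "K = {(p, q, r, z). \<delta> \<le> p \<and> \<delta> \<le> q \<and> \<delta> \<le> r \<and> 0 \<le> z \<and> \<Lambda> p q r z = 1}"
  have "K \<subseteq> {\<delta>..M} \<times> {\<delta>..M} \<times> {\<delta>..M} \<times> {0..1 / (4 * n * b)}"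
  proof
    fix Y assume "Y \<in> K"
    then obtain p q r z where Y: "Y = (p, q, r, z)" "\<delta> \<le> p" "\<delta> \<le> q" "\<delta> \<le> r" "0 \<le> z" "\<Lambda> p q r z = 1"
      by (auto simp: K_def)
    then show "Y \<in> {\<delta>..M} \<times> {\<delta>..M} \<times> {\<delta>..M} \<times> {0..1 / (4 * n * b)}"
      using le[of p q r z] \<delta>(1) by simp
  qed
  moreover have "closed K"
    unfolding K_def \<Lambda>_def case_prod_beta
    by (intro closed_Collect_conj closed_Collect_le closed_Collect_eq continuous_intros)
  ultimately have "compact K"
    using closed_Int_compact[of K "{\<delta>..M} \<times> {\<delta>..M} \<times> {\<delta>..M} \<times> {0..1 / (4 * n * b)}"]
    by (simp add: compact_Times Int_absorb2)
  moreover have \<tau>K: "(\<tau>, \<tau>, \<tau>, 0) \<in> K"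
  proof -
    have "(a1 + a2 + a3) * \<tau> = 1" using a by (simp add: \<tau>_def)
    then have "a1 * \<tau> + a2 * \<tau> + a3 * \<tau> = 1" by (simp only: distrib_right)
    then show ?thesis using \<delta>(2) by (simp add: K_def \<Lambda>_def)
  qed
  moreover have "continuous_on K (\<lambda>(p, q, r, z). scalar_curv n p q r z)"
    unfolding scalar_curv_def case_prod_beta
    by (intro continuous_intros) (use \<delta>(1) in \<open>auto simp: K_def\<close>)
  ultimately obtain Y where Y: "Y \<in> K" "\<And>Y'. Y' \<in> K \<Longrightarrow>
      (\<lambda>(p, q, r, z). scalar_curv n p q r z) Y' \<le> (\<lambda>(p, q, r, z). scalar_curv n p q r z) Y"
    using continuous_attains_sup[of K "\<lambda>(p, q, r, z). scalar_curv n p q r z"] by blast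
  obtain p q r z where Y_eq: "Y = (p, q, r, z)" by (cases Y) auto
  have pos: "p > 0" "q > 0" "r > 0" "z \<ge> 0" "\<Lambda> p q r z = 1"
    using Y(1) \<delta>(1) by (auto simp: Y_eq K_def)
  have max: "scalar_curv n p' q' r' z' \<le> scalar_curv n p q r z" if "(p', q', r', z') \<in> K" for p' q' r' z'
    using Y(2)[OF that] by (simp add: Y_eq)
  have m_le: "m \<le> scalar_curv n p q r z"
    using max[OF \<tau>K] \<tau> by (simp add: scalar_curv_def[of n \<tau>] m_def)
  have "scalar_curv n p' q' r' z' \<le> scalar_curv n p q r z * \<Lambda> p' q' r' z'"
    if "p' > 0" "q' > 0" "r' > 0" "z' \<ge> 0" for p' q' r' z'
  proof -
    define l where "l = \<Lambda> p' q' r' z'"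
    have l: "l > 0" using that a n b by (simp add: l_def \<Lambda>_def add_pos_nonneg add_pos_pos)
    define P Q R Z where "P = p' / l" and "Q = q' / l" and "R = r' / l" and "Z = z' / l"
    have PQ: "P > 0" "Q > 0" "R > 0" "Z \<ge> 0" using that l by (simp_all add: P_def Q_def R_def Z_def)
    have 1: "\<Lambda> P Q R Z = 1"
      using l by (simp add: \<Lambda>_def P_def Q_def R_def Z_def flip: add_divide_distrib)
        (simp add: l_def \<Lambda>_def)
    have "scalar_curv n P Q R Z \<le> scalar_curv n p q r z"
    proof (cases "(P, Q, R, Z) \<in> K")
      case False
      then have "P \<le> \<delta> \<or> Q \<le> \<delta> \<or> R \<le> \<delta>" using PQ 1 by (auto simp: K_def)
      then show ?thesis using small[OF PQ 1] m_le by simp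
    qed (rule max)
    then have "l * scalar_curv n P Q R Z \<le> l * scalar_curv n p q r z" using l by simp
    moreover have "l * scalar_curv n P Q R Z = scalar_curv n p' q' r' z'"
      using scalar_curv_scale[OF l PQ(1-3), of n Z] l by (simp add: P_def Q_def R_def Z_def)
    ultimately show ?thesis by (simp add: l_def mult.commute)
  qed
  then show ?thesis
    using that[of p q r z] pos m m_le by (simp add: \<Lambda>_def)
qed

section \<open>The critical point equations\<close>

lemma scalar_curv_has_derivative:
  assumes "p > 0" "q > 0" "r > 0"
  shows "((\<lambda>p. scalar_curv n p q r z) has_real_derivative
    4 + 2 * q * r / p\<^sup>2 - 2 * (r / q + q / r) + 4 * n * z\<^sup>2 / p\<^sup>2) (at p)"
proof -
  define k l where "k = 4 - 2 * (r / q + q / r)" and "l = 2 * q * r + 4 * n * z\<^sup>2"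
  have 1: "scalar_curv n s q r z = k * s - l * inverse s
      + (4 * (q + r) + 4 * n * (4 * n + 8) * z - 4 * n * z\<^sup>2 * (1 / q + 1 / r))" for s
    by (simp add: scalar_curv_def k_def l_def divide_inverse algebra_simps)
  have 2: "((\<lambda>s. k * s - l * inverse s + c) has_real_derivative k + l * inverse (p\<^sup>2)) (at p)" for c
    using assms(1) by (auto intro!: derivative_eq_intros simp: power2_eq_square)
  have 3: "4 + 2 * q * r / p\<^sup>2 - 2 * (r / q + q / r) + 4 * n * z\<^sup>2 / p\<^sup>2 = k + l * inverse (p\<^sup>2)"
    by (simp add: k_def l_def divide_inverse algebra_simps)
  show ?thesis unfolding 1 3 by (rule 2)
qed

lemma scalar_curv_critical:
  assumes pos: "p > 0" "q > 0" "r > 0"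
    and max: "\<And>p'. p' > 0 \<Longrightarrow> scalar_curv n p' q r z \<le> \<mu> * (a * p' + d)"
    and eq: "scalar_curv n p q r z = \<mu> * (a * p + d)"
  shows "4 + 2 * q * r / p\<^sup>2 - 2 * (r / q + q / r) + 4 * n * z\<^sup>2 / p\<^sup>2 = \<mu> * a"
proof -
  have "((\<lambda>p. scalar_curv n p q r z - \<mu> * (a * p + d)) has_real_derivative
    4 + 2 * q * r / p\<^sup>2 - 2 * (r / q + q / r) + 4 * n * z\<^sup>2 / p\<^sup>2 - \<mu> * a) (at p)"
    by (rule derivative_eq_intros scalar_curv_has_derivative pos refl)+ simp
  from DERIV_local_max[OF this, of p] show ?thesis
    using max eq pos by simp
qed

text \<open>The solution is \<open>x1 = z / p\<close>, \<open>x2 = z / q\<close>,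
  \<open>x3 = z / r\<close>: the critical metric rescaled to s = 1, which needs
  \<open>z > 0\<close>. The constant \<open>c\<close> is the maximal value.\<close>

proposition prescribed_ricci_equations:
  fixes n b a1 a2 a3 :: real
  assumes n: "n > 0" and b: "b > 0" and a: "a1 > 0" "a2 > 0" "a3 > 0"
    and ab: "b / a1 < 2 * n + 4" "b / a2 < 2 * n + 4" "b / a3 < 2 * n + 4"
  obtains x1 x2 x3 c where "x1 > 0" "x2 > 0" "x3 > 0" "c > 0"
    "2 * (x1\<^sup>2 - (x2 - x3)\<^sup>2) / (x2 * x3) + 4 * n * x1\<^sup>2 = c * a1"
    "2 * (x2\<^sup>2 - (x3 - x1)\<^sup>2) / (x3 * x1) + 4 * n * x2\<^sup>2 = c * a2"
    "2 * (x3\<^sup>2 - (x1 - x2)\<^sup>2) / (x1 * x2) + 4 * n * x3\<^sup>2 = c * a3"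
    "4 * n + 8 - 2 * (x1 + x2 + x3) = c * b"
proof -
  obtain p q r z where pos: "p > 0" "q > 0" "r > 0" and z: "z \<ge> 0"
    and one: "a1 * p + a2 * q + a3 * r + 4 * n * b * z = 1" and \<mu>_pos: "scalar_curv n p q r z > 0"
    and max: "\<And>p' q' r' z'. p' > 0 \<Longrightarrow> q' > 0 \<Longrightarrow> r' > 0 \<Longrightarrow> z' \<ge> 0 \<Longrightarrow>
       scalar_curv n p' q' r' z' \<le> scalar_curv n p q r z * (a1 * p' + a2 * q' + a3 * r' + 4 * n * b * z')"
    using scalar_curv_max_exists[OF n b a] by blast
  define \<mu> where "\<mu> = scalar_curv n p q r z"
  note max = max[folded \<mu>_def]
  define k where "k = 4 * n * (4 * n + 8) - 8 * n * z * (1 / p + 1 / q + 1 / r) - \<mu> * (4 * n * b)"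
  define f where "f w = scalar_curv n p q r w - \<mu> * (a1 * p + a2 * q + a3 * r + 4 * n * b * w)" for w
  have f_deriv: "(f has_real_derivative k) (at z)"
    unfolding f_def scalar_curv_def k_def
    by (rule derivative_eq_intros refl)+ simp
  have f_max: "f w \<le> f z" if "w \<ge> 0" for w
    using max[of p q r w] pos that one by (simp add: f_def \<mu>_def)
  have z_pos: "z > 0"
  proof (rule ccontr)
    assume "\<not> z > 0"
    with z have z0: "z = 0" by simp
    have "\<mu> \<le> 2 * (p + q + r)"
      using scalar_curv_zero_le[OF pos] z0 by (simp add: \<mu>_def)
    \<comment> \<open>Weighted by \<open>p\<close>, \<open>q\<close>, \<open>r\<close> and added up,
      the bounds meet the constraint, which has no \<open>z\<close> term here. Twice
      \<open>2 * n + 4\<close> is the constant \<open>4 * n + 8\<close> of the horizontal Ricci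
      coefficient.\<close>
    moreover have "b < (2 * n + 4) * a1" "b < (2 * n + 4) * a2" "b < (2 * n + 4) * a3"
      using ab a by (simp_all add: field_simps)
    then have "b * p < (2 * n + 4) * a1 * p" "b * q < (2 * n + 4) * a2 * q" "b * r < (2 * n + 4) * a3 * r"
      using pos by simp_all
    then have "b * (p + q + r) < (2 * n + 4) * (a1 * p + a2 * q + a3 * r)"
      by (simp add: algebra_simps)
    moreover have "a1 * p + a2 * q + a3 * r = 1" using one z0 by simp
    moreover have "b * \<mu> \<le> 2 * (b * (p + q + r))"
      using \<open>\<mu> \<le> 2 * (p + q + r)\<close> mult_left_mono[of \<mu> "2 * (p + q + r)" b] b by simp
    ultimately have "b * \<mu> < 4 * n + 8" by simp
    then have "4 * n * (b * \<mu>) < 4 * n * (4 * n + 8)" using n by simp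
    then have "k > 0" by (simp add: k_def z0 algebra_simps)
    with f_deriv z0 obtain d where d: "d > 0" "\<And>h. 0 < h \<Longrightarrow> h < d \<Longrightarrow> f z < f (z + h)"
      using DERIV_pos_inc_right by blast
    show False using d(2)[of "d / 2"] d(1) f_max[of "z + d / 2"] z by simp
  qed
  have "k = 0"
    by (rule DERIV_local_max[OF f_deriv z_pos]) (use f_max z_pos in auto)
  moreover have "k = 4 * n * (4 * n + 8 - 2 * (z / p + z / q + z / r) - \<mu> * b)"
    by (simp add: k_def algebra_simps)
  ultimately have kz: "4 * n + 8 - 2 * (z / p + z / q + z / r) = \<mu> * b"
    using n by simp
  have e1: "4 + 2 * q * r / p\<^sup>2 - 2 * (r / q + q / r) + 4 * n * z\<^sup>2 / p\<^sup>2 = \<mu> * a1"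
    by (rule scalar_curv_critical[OF pos, where d = "a2 * q + a3 * r + 4 * n * b * z"])
      (use max[of _ q r z] pos z one in \<open>simp_all add: \<mu>_def algebra_simps\<close>)
  have e2: "4 + 2 * r * p / q\<^sup>2 - 2 * (p / r + r / p) + 4 * n * z\<^sup>2 / q\<^sup>2 = \<mu> * a2"
    by (rule scalar_curv_critical[OF pos(2,3,1), where d = "a1 * p + a3 * r + 4 * n * b * z"])
      (use max[of p _ r z] pos z one in \<open>simp_all add: \<mu>_def algebra_simps flip: scalar_curv_rotate[of n p]\<close>)
  have e3: "4 + 2 * p * q / r\<^sup>2 - 2 * (q / p + p / q) + 4 * n * z\<^sup>2 / r\<^sup>2 = \<mu> * a3"
    by (rule scalar_curv_critical[OF pos(3,1,2), where d = "a1 * p + a2 * q + 4 * n * b * z"])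
      (use max[of p q _ z] pos z one in \<open>simp_all add: \<mu>_def algebra_simps scalar_curv_rotate[of n _ p q]\<close>)
  have aux: "2 * ((z / p)\<^sup>2 - (z / q - z / r)\<^sup>2) / (z / q * (z / r)) + 4 * n * (z / p)\<^sup>2 =
      4 + 2 * q * r / p\<^sup>2 - 2 * (r / q + q / r) + 4 * n * z\<^sup>2 / p\<^sup>2"
    if "p > 0" "q > 0" "r > 0" for p q r
    using that z_pos by (simp add: field_simps power2_eq_square)
  show ?thesis
    using that[of "z / p" "z / q" "z / r" \<mu>] pos z_pos \<mu>_pos kz e1 e2 e3
      aux[OF pos] aux[OF pos(2,3,1)] aux[OF pos(3,1,2)]
    by (simp add: \<mu>_def)
qed

section \<open>Invariant metrics on the quaternionic sphere\<close>

lemma inner_quat_mult_left: "inner (a * b) c = inner b (qcnj a * c)" for a b c :: quat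
  by (simp add: inner_quat_def algebra_simps)

lemma inner_quat_mult_right: "inner (a * b) c = inner a (c * qcnj b)" for a b c :: quat
  by (simp add: inner_quat_def algebra_simps)

lemma qcnj_mult: "qcnj (a * b) = qcnj b * qcnj a"
  by (simp add: quat_eq_iff algebra_simps)

lemma qcnj_diff: "qcnj (a - b) = qcnj a - qcnj b"
  by (simp add: quat_eq_iff)

lemma qcnj_qcnj [simp]: "qcnj (qcnj a) = a" and qcnj_0 [simp]: "qcnj 0 = 0" and qcnj_1 [simp]: "qcnj 1 = 1"
  by (simp_all add: quat_eq_iff)

lemma qcnj_imaginary: "qRe a = 0 \<Longrightarrow> qcnj a = - a"
  by (simp add: quat_eq_iff)

lemma qcnj_mult_self: "qcnj a * a = of_real (inner a a)" "a * qcnj a = of_real (inner a a)"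
  by (simp_all add: quat_eq_iff of_real_def inner_quat_def algebra_simps)

lemma imaginary_square:
  assumes "qRe a = 0" shows "a * a = - of_real (inner a a)"
  using assms by (simp add: quat_eq_iff of_real_def inner_quat_def algebra_simps)

lemma imaginary_anticommute:
  assumes "qRe a = 0" "qRe b = 0" "inner a b = 0" shows "b * a = - (a * b)"
  using assms by (simp add: quat_eq_iff inner_quat_def algebra_simps)

definition hright :: "quat \<Rightarrow> ('n::finite) hvec \<Rightarrow> 'n hvec" where
  "hright a v = (\<chi> i. v $ i * a)"

lemma hright_nth [simp]: "hright a v $ i = v $ i * a"
  by (simp add: hright_def)

lemma linear_hright: "linear (hright a)"
  by (rule linearI) (simp_all add: vec_eq_iff algebra_simps)

lemma hright_hright: "hright a (hright b v) = hright (b * a) v"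
  by (simp add: vec_eq_iff mult.assoc)

lemma inner_hright: "inner (hright a u) v = inner u (hright (qcnj a) v)"
  by (simp add: inner_vec_def inner_quat_mult_right)

lemma mult_hright: "A *v hright a v = hright a (A *v v)"
  by (simp add: vec_eq_iff matrix_vector_mult_def sum_distrib_right mult.assoc)

lemma hright_base_point: "hright a base_point = axis None a"
  by (simp add: vec_eq_iff base_point_def axis_def)

lemma mult_base_point_nth: "(A *v base_point) $ i = A $ i $ None"
  by (simp add: matrix_vector_mult_def base_point_def axis_def if_distrib[of "(*) _"] cong: if_cong)

lemma inner_axis_None: "inner (axis None a) v = inner a (v $ None)" for v :: "('n::finite) hvec"
  by (simp add: inner_vec_def axis_def if_distrib[of "\<lambda>z. inner z _"] cong: if_cong)

lemma inner_hadjoint: "inner (A *v u) v = inner u (hadjoint A *v v)"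
proof -
  have "inner (A *v u) v = (\<Sum>i\<in>UNIV. \<Sum>j\<in>UNIV. inner (u $ j) (qcnj (A $ i $ j) * v $ i))"
    by (simp add: inner_vec_def matrix_vector_mult_def inner_sum_left inner_quat_mult_left)
  also have "\<dots> = inner u (hadjoint A *v v)"
    by (subst sum.swap) (simp add: inner_vec_def matrix_vector_mult_def inner_sum_right hadjoint_def)
  finally show ?thesis .
qed

lemma Sp_inner:
  assumes "A \<in> Sp_group"
  shows "inner (A *v u) (A *v v) = inner u v"
  using assms by (simp add: inner_hadjoint Sp_group_def matrix_vector_mul_assoc)

lemma Sp_sphere: "A \<in> Sp_group \<Longrightarrow> A *v p \<in> sphere 0 1 \<longleftrightarrow> p \<in> sphere 0 1"
  using Sp_inner[of A p p] by (simp add: norm_eq_sqrt_inner)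

lemma Sp_tangent: "A \<in> Sp_group \<Longrightarrow> A *v u \<in> sphere_tangent (A *v p) \<longleftrightarrow> u \<in> sphere_tangent p"
  using Sp_inner[of A p u] by (simp add: sphere_tangent_def)

lemma linear_matrix_vector_quat: "linear ((*v) A)" for A :: "('n::finite) hmat"
  by (rule linearI)
    (simp_all add: vec_eq_iff matrix_vector_mult_def algebra_simps sum.distrib scaleR_sum_right)

text \<open>\<open>Sp_group\<close> provides a left inverse only; surjectivity follows from
  injectivity in finite real dimension.\<close>

lemma Sp_surj:
  assumes "A \<in> Sp_group"
  obtains u where "v = A *v u"
proof -
  have "inj ((*v) A)"
  proof (rule injI)
    fix u u' assume "A *v u = A *v u'"
    then have "A *v (u - u') = 0" using linear_diff[OF linear_matrix_vector_quat, of A u u'] by simp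
    then show "u = u'" using Sp_inner[OF assms, of "u - u'" "u - u'"] by simp
  qed
  then have "surj ((*v) A)"
    using linear_injective_imp_surjective[OF linear_matrix_vector_quat] by blast
  then show ?thesis using that by (metis surjD)
qed

text \<open>The unitary reflection \<open>x \<mapsto> x - w l \<langle>w, x\<rangle>\<close> along \<open>w = p - o\<close>, where the quaternion
  \<open>l\<close> is determined by the condition that \<open>o\<close> is mapped to \<open>p\<close>.\<close>

lemma Sp_transitive:
  fixes p :: "('n::finite) hvec"
  assumes p: "p \<in> sphere 0 1"
  obtains A where "A \<in> Sp_group" "A *v base_point = p"
proof (cases "p = base_point")
  case True
  have "mat 1 \<in> (Sp_group :: 'n hmat set)"
  proof -
    have "hadjoint (mat 1) = (mat 1 :: 'n hmat)"
      by (simp add: hadjoint_def vec_eq_iff mat_def)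
    then show ?thesis by (simp add: Sp_group_def)
  qed
  then show ?thesis using that[of "mat 1"] True by simp
next
  case False
  define w where "w = p - base_point"
  define h where "h = p $ None"
  define s where "s = inner (1 - h) (1 - h)"
  \<comment> \<open>Since \<open>w $ None = h - 1\<close>, the base point goes to \<open>p\<close>
    exactly when \<open>l * qcnj (1 - h) = 1\<close>.\<close>
  define l where "l = (1 / s) *\<^sub>R (1 - h)"
  have pp: "inner p p = 1" using p by (simp add: norm_eq_1)
  have "inner p base_point = qRe h" "inner base_point (base_point :: 'n hvec) = 1"
    by (simp_all add: base_point_def inner_axis_None inner_commute[of p] h_def inner_quat_def)
  then have "inner w w = 2 - 2 * qRe h"
    by (simp add: w_def inner_diff pp inner_commute)
  moreover have w_sum: "(\<Sum>i\<in>UNIV. qcnj (w $ i) * w $ i) = of_real (inner w w)"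
    by (simp add: qcnj_mult_self inner_vec_def)
  ultimately have ww: "(\<Sum>i\<in>UNIV. qcnj (w $ i) * w $ i) = of_real (2 - 2 * qRe h)"
    by simp
  have "h \<noteq> 1"
  proof
    assume "h = 1"
    then have "w = 0" using ww w_sum by simp
    with False show False by (simp add: w_def)
  qed
  then have s: "s > 0" by (simp add: s_def)
  define A :: "'n hmat" where "A = (\<chi> i j. (if i = j then 1 else 0) - w $ i * l * qcnj (w $ j))"
  have l1: "l * qcnj (1 - h) = 1" "qcnj l = (1 / s) *\<^sub>R qcnj (1 - h)"
  proof -
    have "l * qcnj (1 - h) = (1 / s) *\<^sub>R of_real s"
      by (simp add: l_def qcnj_mult_self s_def)
    then show "l * qcnj (1 - h) = 1" using s by (simp add: of_real_def)
  qed (simp add: l_def quat_eq_iff)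
  \<comment> \<open>The condition for the reflection to be unitary, with
    \<open>2 - 2 * qRe h\<close> the squared norm of \<open>w\<close>.\<close>
  have l2: "l + qcnj l = qcnj l * of_real (2 - 2 * qRe h) * l"
  proof -
    have "inner l l = 1 / s" using s by (simp add: l_def flip: s_def)
    then have "qcnj l * l = of_real (1 / s)" by (simp only: qcnj_mult_self)
    moreover have "qcnj l * of_real (2 - 2 * qRe h) * l = (2 - 2 * qRe h) *\<^sub>R (qcnj l * l)"
      by (simp add: of_real_def)
    moreover have "l + qcnj l = of_real ((2 - 2 * qRe h) / s)"
      by (simp add: l_def quat_eq_iff of_real_def diff_divide_distrib right_diff_distrib)
    ultimately show ?thesis by (simp add: of_real_def)
  qed
  have "A *v base_point = p"
  proof -
    have "qcnj (w $ None) = - qcnj (1 - h)"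
      by (simp add: w_def h_def base_point_def axis_def quat_eq_iff)
    then have "(A *v base_point) $ i = (if i = None then 1 else 0) + w $ i" for i
      using l1 by (simp add: mult_base_point_nth A_def mult.assoc)
    then show ?thesis by (simp add: vec_eq_iff w_def base_point_def axis_def)
  qed
  moreover have "A \<in> Sp_group"
  proof -
    have "(\<Sum>k\<in>UNIV. qcnj (A $ k $ i) * A $ k $ j) = (if i = j then 1 else 0)" for i j
    proof -
      have "(\<Sum>k\<in>UNIV. qcnj (A $ k $ i) * A $ k $ j) =
        (\<Sum>k\<in>UNIV. (if k = i then if i = j then 1 else 0 else 0) - (if k = i then w $ i * l * qcnj (w $ j) else 0)
          - (if k = j then w $ i * qcnj l * qcnj (w $ j) else 0)
          + w $ i * qcnj l * (qcnj (w $ k) * w $ k) * l * qcnj (w $ j))"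
        by (intro sum.cong refl) (auto simp: A_def qcnj_diff qcnj_mult algebra_simps)
      also have "\<dots> = (if i = j then 1 else 0) - w $ i * l * qcnj (w $ j) - w $ i * qcnj l * qcnj (w $ j)
          + w $ i * qcnj l * (\<Sum>k\<in>UNIV. qcnj (w $ k) * w $ k) * l * qcnj (w $ j)"
        by (simp add: sum.distrib sum_subtractf sum_distrib_left sum_distrib_right)
      also have "\<dots> = (if i = j then 1 else 0)
          - w $ i * (l + qcnj l - qcnj l * of_real (2 - 2 * qRe h) * l) * qcnj (w $ j)"
        unfolding ww by (simp only: distrib_left distrib_right left_diff_distrib right_diff_distrib
            mult.assoc diff_diff_eq[symmetric] diff_diff_eq2[symmetric]) simp
      finally show ?thesis using l2 by simp
    qed
    then show ?thesis
      by (simp add: Sp_group_def hadjoint_def matrix_matrix_mult_def vec_eq_iff mat_def)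
  qed
  ultimately show ?thesis using that by blast
qed

section \<open>Vertical frames as orthonormal imaginary quaternions\<close>

text \<open>The matrix whose only entry is \<open>quat_i\<close>, at the diagonal place
  \<open>Some m\<close>, annihilates the base point. An \<open>A\<close> commuting with it keeps
  \<open>A *v base_point\<close> in its kernel, which forces the coordinate \<open>Some m\<close> to
  vanish.\<close>

lemma vertical_mult_base_point:
  fixes A :: "('n::finite) hmat"
  assumes A: "A \<in> vertical_algebra"
  shows "A *v base_point = axis None (A $ None $ None)" "qRe (A $ None $ None) = 0"
proof -
  have sp: "hadjoint A + A = 0" using A by (simp add: vertical_algebra_def sp_algebra_def)
  then have "(hadjoint A + A) $ None $ None = 0" by simp
  then show "qRe (A $ None $ None) = 0" by (simp add: hadjoint_def quat_eq_iff)
  have "A $ Some m $ None = 0" for m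
  proof -
    define B :: "'n hmat" where "B = (\<chi> i j. if i = Some m \<and> j = Some m then quat_i else 0)"
    have B0: "B *v base_point = 0" by (simp add: vec_eq_iff mult_base_point_nth B_def)
    moreover have "hadjoint B + B = 0"
      by (simp add: vec_eq_iff hadjoint_def B_def quat_eq_iff)
    ultimately have "B \<in> isotropy_algebra" by (simp add: isotropy_algebra_def sp_algebra_def)
    then have "mat_bracket A B = 0" using A by (simp add: vertical_algebra_def)
    then have "A *v (B *v base_point) = B *v (A *v base_point)"
      by (simp add: mat_bracket_def matrix_vector_mul_assoc)
    then have "(B *v (A *v base_point)) $ Some m = 0"
      using B0 by simp
    moreover have "(B *v (A *v base_point)) $ Some m
        = (\<Sum>j\<in>UNIV. if j = Some m then quat_i * A $ j $ None else 0)"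
      unfolding matrix_vector_mult_def[of B] vec_lambda_beta
      by (intro sum.cong refl) (simp add: mult_base_point_nth B_def)
    then have "(B *v (A *v base_point)) $ Some m = quat_i * A $ Some m $ None" by simp
    ultimately show ?thesis by (simp add: quat_eq_iff)
  qed
  then show "A *v base_point = axis None (A $ None $ None)"
    by (auto simp: vec_eq_iff mult_base_point_nth axis_def)
qed

lemma DIM_hvec: "DIM(('n::finite) hvec) = 4 * CARD('n) + 4"
proof -
  have "card {1, quat_i, quat_j, quat_k} = 4"
    by (simp add: quat_eq_iff card_insert_if)
  then show ?thesis by (simp add: Basis_quat_def)
qed

text \<open>What a vertical frame leaves at the entry \<open>None\<close>, \<open>None\<close>. The
  bracket fixes the orientation: \<open>q i * q (i + 1)\<close> is \<open>q (i + 2)\<close> and not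
  its negative.\<close>

locale vertical_quaternions =
  fixes q :: "3 \<Rightarrow> quat"
  assumes q_imaginary: "qRe (q i) = 0"
    and q_orthonormal: "inner (q i) (q j) = (if i = j then 1 else 0)"
    and q_bracket: "q i * q (i + 1) - q (i + 1) * q i = 2 *\<^sub>R q (i + 2)"
begin

lemma three_neq: "i \<noteq> i + (1::3)"
  using exhaust_3[of i] by auto

lemma q_square: "q i * q i = - 1"
  using imaginary_square[OF q_imaginary, of i] by (simp add: q_orthonormal)

lemma q_mult: "q i * q (i + 1) = q (i + 2)" "q (i + 1) * q i = - q (i + 2)"
proof -
  have *: "q (i + 1) * q i = - (q i * q (i + 1))"
    using three_neq[of i] by (intro imaginary_anticommute) (simp_all add: q_imaginary q_orthonormal)
  then have "2 *\<^sub>R (q i * q (i + 1)) = 2 *\<^sub>R q (i + 2)"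
    using q_bracket[of i] by (simp add: scaleR_2)
  then show "q i * q (i + 1) = q (i + 2)" by simp
  with * show "q (i + 1) * q i = - q (i + 2)" by simp
qed

text \<open>Such a \<open>w\<close> anticommutes with every \<open>q i\<close>, hence commutes with
  \<open>q 1 * q 2 = q 3\<close>. So \<open>w * q 3\<close> is its own negative, and
  \<open>q 3\<close> is invertible.\<close>

lemma q_complete:
  assumes "qRe w = 0" "\<And>i. inner w (q i) = 0"
  shows "w = 0"
proof -
  have a: "q i * w = - (w * q i)" for i
    using assms q_imaginary by (intro imaginary_anticommute)
  have "w * q 3 = w * q 1 * q 2" using q_mult(1)[of 1] by (simp add: mult.assoc three_add)
  also have "\<dots> = q 1 * q 2 * w" using a[of 1] a[of 2] by (simp add: mult.assoc) (metis minus_mult_right mult.assoc minus_minus mult_minus_left)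
  also have "\<dots> = - (w * q 3)" using q_mult(1)[of 1] a[of 3] by (simp add: three_add)
  finally have "w * q 3 = 0" by (simp add: eq_neg_iff_add_eq_0 flip: scaleR_2)
  then have "w * q 3 * q 3 = 0" by simp
  then show ?thesis using q_square[of 3] by (simp add: mult.assoc)
qed

lemma quaternionic_structure_hright:
  "quaternionic_structure (\<lambda>i. hright (q i) :: ('n::finite) hvec \<Rightarrow> 'n hvec)"
proof (rule quaternionic_structure.intro)
  fix i :: 3 and u v :: "'n hvec"
  have neg: "hright (- a) u = - hright a u" for a by (simp add: vec_eq_iff)
  show "linear (hright (q i) :: 'n hvec \<Rightarrow> 'n hvec)" by (rule linear_hright)
  show "inner (hright (q i) u) v = - inner u (hright (q i) v)"
    by (simp add: inner_hright qcnj_imaginary[OF q_imaginary]) (simp add: inner_vec_def sum_negf)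
  show "hright (q i) (hright (q i) u) = - u"
    by (simp add: hright_hright q_square) (simp add: vec_eq_iff)
  show "hright (q i) (hright (q (i + 1)) u) = - hright (q (i + 2)) u"
    by (simp add: hright_hright q_mult neg)
  show "hright (q (i + 1)) (hright (q i) u) = hright (q (i + 2)) u"
    by (simp add: hright_hright q_mult)
qed

end

text \<open>The bracket relation is applied to the base point and read at \<open>None\<close>. As
  \<open>e j *v base_point\<close> is supported there, only the corner entries multiply.\<close>

lemma vertical_frame_quaternions:
  fixes e :: "3 \<Rightarrow> ('n::finite) hmat"
  assumes e: "vertical_frame e"
  shows "vertical_quaternions (\<lambda>i. e i $ None $ None)"
    and "e i *v base_point = hright (e i $ None $ None) base_point"
proof -
  have v: "e i \<in> vertical_algebra" for i using e by (simp add: vertical_frame_def)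
  note eo = vertical_mult_base_point[OF v]
  show "e i *v base_point = hright (e i $ None $ None) base_point"
    by (simp add: eo hright_base_point)
  have m: "(e i *v (e j *v base_point)) $ None = e i $ None $ None * e j $ None $ None" for i j
    unfolding eo by (simp add: matrix_vector_mult_def axis_def if_distrib[of "(*) _"] cong: if_cong)
  show "vertical_quaternions (\<lambda>i. e i $ None $ None)"
  proof
    fix i j
    show "qRe (e i $ None $ None) = 0" by (rule eo)
    show "inner (e i $ None $ None) (e j $ None $ None) = (if i = j then 1 else 0)"
      using e by (simp add: vertical_frame_def eo inner_axis_None)
    have "mat_bracket (e i) (e (i + 1)) *v base_point = (2 *\<^sub>R e (i + 2)) *v base_point"
      using e by (simp add: vertical_frame_def)
    then have "e i *v (e (i + 1) *v base_point) - e (i + 1) *v (e i *v base_point)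
        = (2 *\<^sub>R e (i + 2)) *v base_point"
      by (simp add: mat_bracket_def matrix_vector_mult_diff_rdistrib matrix_vector_mul_assoc)
    from arg_cong[OF this, of "\<lambda>v. v $ None"]
    have "(e i *v (e (i + 1) *v base_point)) $ None - (e (i + 1) *v (e i *v base_point)) $ None
        = ((2 *\<^sub>R e (i + 2)) *v base_point) $ None"
      by simp
    then show "e i $ None $ None * e (i + 1) $ None $ None - e (i + 1) $ None $ None * e i $ None $ None
        = 2 *\<^sub>R e (i + 2) $ None $ None"
      unfolding m by (simp add: mult_base_point_nth)
  qed
qed

lemma (in vertical_quaternions) invariant_metric_deformation:
  assumes "hopf_deformation (\<lambda>i. hright (q i) :: ('n::finite) hvec \<Rightarrow> 'n hvec) x"
  shows "invariant_metric (hopf_deformation.metric (\<lambda>i. hright (q i) :: 'n hvec \<Rightarrow> 'n hvec) x)"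
proof -
  interpret hopf_deformation "\<lambda>i. hright (q i) :: 'n hvec \<Rightarrow> 'n hvec" x by (rule assms)
  show ?thesis
    by (simp add: invariant_metric_def riemannian_metric) (simp add: metric_def Sp_inner flip: mult_hright)
qed

text \<open>\<open>hopf_metric\<close> prescribes values on the frame and on horizontal vectors
  only; splitting into \<open>P u\<close> and \<open>H u\<close> extends them to all tangent
  vectors.\<close>

lemma hopf_metric_base_point:
  fixes e :: "3 \<Rightarrow> ('n::finite) hmat"
  assumes e: "vertical_frame e" and T: "hopf_metric e a b T"
    and u: "u \<in> sphere_tangent base_point" and v: "v \<in> sphere_tangent base_point"
  defines "J \<equiv> \<lambda>i. hright (e i $ None $ None)"
  shows "T base_point u v = b * (inner u v - (\<Sum>i\<in>UNIV. inner u (J i base_point) * inner v (J i base_point)))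
    + (\<Sum>i\<in>UNIV. a i * (inner u (J i base_point) * inner v (J i base_point)))"
proof -
  let ?o = "base_point :: 'n hvec"
  interpret q: vertical_quaternions "\<lambda>i. e i $ None $ None" by (rule vertical_frame_quaternions[OF e])
  interpret quaternionic_structure "J :: 3 \<Rightarrow> 'n hvec \<Rightarrow> 'n hvec"
    unfolding J_def by (rule q.quaternionic_structure_hright)
  have eJ: "e i *v ?o = J i ?o" for i
    unfolding J_def by (rule vertical_frame_quaternions[OF e])
  have J_orth: "inner (J i ?o) (J j ?o) = (if i = j then 1 else 0)" for i j
    using e by (simp add: vertical_frame_def flip: eJ)
  have J_tan: "J i ?o \<in> sphere_tangent ?o" for i
    by (simp add: sphere_tangent_def)
  have sub: "subspace (sphere_tangent ?o)" by (rule subspace_sphere_tangent)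
  have o: "?o \<in> sphere 0 1"
    by (simp add: base_point_def norm_eq_sqrt_inner inner_axis_None) (simp add: inner_quat_def)
  have T_add: "T ?o (u + v) w = T ?o u w + T ?o v w" and T_scale: "T ?o (r *\<^sub>R u) w = r * T ?o u w"
    and T_sym: "T ?o u w = T ?o w u"
    if "u \<in> sphere_tangent ?o" "v \<in> sphere_tangent ?o" "w \<in> sphere_tangent ?o" for u v w r
    using T o that by (auto simp: hopf_metric_def invariant_metric_def riemannian_metric_def)
  define P where "P u = (\<Sum>i\<in>UNIV. inner u (J i ?o) *\<^sub>R J i ?o)" for u
  define H where "H u = u - P u" for u
  have HJ: "inner (H u) (J i ?o) = 0" for u i
    using exhaust_3[of i] unfolding H_def P_def sum_3 by (auto simp: inner_simps J_orth)
  have P_tan: "P u \<in> sphere_tangent ?o" for u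
    unfolding P_def by (intro subspace_sum subspace_scale sub J_tan)
  have H_tan: "H u \<in> sphere_tangent ?o" if "u \<in> sphere_tangent ?o" for u
    unfolding H_def by (intro subspace_diff sub that P_tan)
  have H_hor: "H u \<in> horizontal_space" if u: "u \<in> sphere_tangent ?o" for u
  proof -
    \<comment> \<open>Horizontality asks for orthogonality to the whole vertical algebra, not just
      to the frame. All its action vectors are supported at \<open>None\<close>, so this vanishing
      suffices.\<close>
    have "H u $ None = 0"
    proof (rule q.q_complete)
      have "inner ?o (H u) = 0" using H_tan[OF u] by (simp add: sphere_tangent_def)
      then show "qRe (H u $ None) = 0" by (simp add: base_point_def inner_axis_None inner_quat_def)
      show "inner (H u $ None) (e i $ None $ None) = 0" for i
        using HJ[of u i] inner_axis_None[of "e i $ None $ None" "H u"]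
        unfolding J_def hright_base_point by (simp add: inner_commute)
    qed
    then have "inner (H u) (A *v ?o) = 0" if "A \<in> vertical_algebra" for A
      by (simp add: vertical_mult_base_point[OF that] inner_commute[of "H u"] inner_axis_None)
    then show ?thesis using H_tan[OF u] by (simp add: horizontal_space_def)
  qed
  have TJJ: "T ?o (J i ?o) (J j ?o) = (if i = j then a i else 0)" for i j
    using T unfolding hopf_metric_def eJ by blast
  have THH: "T ?o (H u) (H v) = b * inner (H u) (H v)"
    using T H_hor[OF u] H_hor[OF v] unfolding hopf_metric_def by blast
  have TJH: "T ?o (J i ?o) (H u) = 0" if "u \<in> sphere_tangent ?o" for i u
    using T H_hor[OF that] unfolding hopf_metric_def eJ by blast
  have TP: "T ?o (P u) w = (\<Sum>i\<in>UNIV. inner u (J i ?o) * T ?o (J i ?o) w)"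
    if "w \<in> sphere_tangent ?o" for u w
    unfolding P_def sum_3 using that
    by (simp add: T_add T_scale J_tan subspace_scale[OF sub] subspace_add[OF sub])
  have split: "T ?o u w = T ?o (H u) w + T ?o (P u) w"
    if "u \<in> sphere_tangent ?o" "w \<in> sphere_tangent ?o" for u w
    using T_add[OF H_tan[OF that(1)] P_tan that(2), of u] by (simp add: H_def)
  have THP: "T ?o (H u) (P v) = 0"
    using T_sym[OF H_tan[OF u] H_tan[OF u] P_tan] TP[OF H_tan[OF u]] TJH[OF u] by simp
  have "T ?o (H u) v = T ?o v (H u)" using T_sym H_tan u v by blast
  also have "\<dots> = T ?o (H v) (H u)"
    using split[OF v H_tan[OF u]] TP[OF H_tan[OF u]] TJH[OF u] by simp
  also have "\<dots> = b * inner (H u) (H v)"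
    using THH T_sym H_tan u v by metis
  finally have 1: "T ?o (H u) v = b * inner (H u) (H v)" .
  have JT: "T ?o (J i ?o) v = a i * inner v (J i ?o)" for i
  proof -
    have "T ?o (J i ?o) v = T ?o v (J i ?o)" using T_sym J_tan v by blast
    also have "\<dots> = T ?o (J i ?o) (H v) + T ?o (P v) (J i ?o)"
      using split[OF v J_tan] T_sym[OF H_tan[OF v] H_tan[OF v] J_tan, of i] by simp
    also have "\<dots> = a i * inner v (J i ?o)"
      using exhaust_3[of i] by (auto simp: TJH v TP J_tan TJJ sum_3)
    finally show ?thesis .
  qed
  have "inner (H u) (H v) = inner (H u) v"
    by (simp add: H_def[of v] P_def[of v] inner_simps inner_sum_right HJ)
  also have "\<dots> = inner u v - (\<Sum>i\<in>UNIV. inner u (J i ?o) * inner v (J i ?o))"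
    by (simp add: H_def P_def inner_simps inner_sum_left inner_commute[of v])
  finally have 2: "inner (H u) (H v) = inner u v - (\<Sum>i\<in>UNIV. inner u (J i ?o) * inner v (J i ?o))" .
  show ?thesis
    unfolding 2[symmetric] using split[OF u v] 1 TP[OF v, of u] JT by (simp add: algebra_simps)
qed

text \<open>The group is transitive and isometric for T, and the right-hand side is invariant
  because \<open>J\<close> commutes with matrices.\<close>

lemma hopf_metric_eq:
  fixes e :: "3 \<Rightarrow> ('n::finite) hmat"
  assumes e: "vertical_frame e" and T: "hopf_metric e a b T" and p: "p \<in> sphere 0 1"
    and u: "u \<in> sphere_tangent p" and v: "v \<in> sphere_tangent p"
  defines "J \<equiv> \<lambda>i. hright (e i $ None $ None)"
  shows "T p u v = b * (inner u v - (\<Sum>i\<in>UNIV. inner u (J i p) * inner v (J i p)))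
    + (\<Sum>i\<in>UNIV. a i * (inner u (J i p) * inner v (J i p)))"
proof -
  obtain A where A: "A \<in> Sp_group" "A *v base_point = p" using Sp_transitive[OF p] by blast
  obtain u' v' where uv: "u = A *v u'" "v = A *v v'" using Sp_surj[OF A(1)] by metis
  have tan: "u' \<in> sphere_tangent base_point" "v' \<in> sphere_tangent base_point"
    using u v unfolding uv A(2)[symmetric] by (simp_all add: Sp_tangent[OF A(1)])
  have "base_point \<in> sphere (0 :: 'n hvec) 1"
    using p unfolding A(2)[symmetric] by (simp only: Sp_sphere[OF A(1)])
  then have "T p u v = T base_point u' v'"
    using T A tan unfolding uv A(2)[symmetric] hopf_metric_def invariant_metric_def by blast
  then show ?thesis
    unfolding hopf_metric_base_point[OF e T tan] uv J_def A(2)[symmetric] mult_hright[symmetric]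
    by (simp add: Sp_inner[OF A(1)])
qed

theorem theoremB:
  fixes e :: "3 \<Rightarrow> ('n::finite) hmat" and a :: "3 \<Rightarrow> real" and b :: real
    and T :: "'n hvec tensor2"
  assumes "vertical_frame e"
    and "\<forall>i. a i > 0" and "b > 0"
    and "hopf_metric e a b T"
    and "\<forall>i. b / a i < 2 * real CARD('n) + 4"
  shows "\<exists>g c. invariant_metric g \<and> c > 0 \<and>
           (\<forall>p\<in>sphere 0 1. \<forall>u\<in>sphere_tangent p. \<forall>v\<in>sphere_tangent p.
              ricci g p u v = c * T p u v)"
proof -
  obtain x1 x2 x3 c where x: "x1 > 0" "x2 > 0" "x3 > 0" and c: "c > 0"
    and eqs: "2 * (x1\<^sup>2 - (x2 - x3)\<^sup>2) / (x2 * x3) + 4 * real CARD('n) * x1\<^sup>2 = c * a 1"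
    "2 * (x2\<^sup>2 - (x3 - x1)\<^sup>2) / (x3 * x1) + 4 * real CARD('n) * x2\<^sup>2 = c * a 2"
    "2 * (x3\<^sup>2 - (x1 - x2)\<^sup>2) / (x1 * x2) + 4 * real CARD('n) * x3\<^sup>2 = c * a 3"
    "4 * real CARD('n) + 8 - 2 * (x1 + x2 + x3) = c * b"
    by (rule prescribed_ricci_equations[of "real CARD('n)" b "a 1" "a 2" "a 3"])
      (use assms in \<open>auto intro: that\<close>)
  define x :: "3 \<Rightarrow> real" where "x i = (if i = 1 then x1 else if i = 2 then x2 else x3)" for i
  have x123: "x 1 = x1" "x 2 = x2" "x 3 = x3" by (simp_all add: x_def)
  interpret q: vertical_quaternions "\<lambda>i. e i $ None $ None"
    by (rule vertical_frame_quaternions[OF assms(1)])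
  let ?J = "\<lambda>i. hright (e i $ None $ None) :: 'n hvec \<Rightarrow> 'n hvec"
  have deformation: "hopf_deformation ?J x"
    using q.quaternionic_structure_hright x
    by (auto simp: hopf_deformation_def hopf_deformation_axioms_def x_def)
  interpret hopf_deformation ?J x by (rule deformation)
  have "ricci metric p u v = c * T p u v"
    if "p \<in> sphere 0 1" "u \<in> sphere_tangent p" "v \<in> sphere_tangent p" for p u v
  proof -
    \<comment> \<open>The ambient dimension is 4n + 4, which turns the Ricci coefficients into the
      left-hand sides of \<open>eqs\<close>.\<close>
    have "real DIM('n hvec) + 4 - 2 * (x1 + x2 + x3) = c * b"
      "real DIM('n hvec) - 4 = 4 * real CARD('n)"
      using eqs(4) by (simp_all add: DIM_hvec del: DIM_cart)
    then show ?thesis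
      unfolding ricci_metric_eq[OF that] hopf_metric_eq[OF assms(1,4) that] sum_3 three_add x123
      by (simp only: eqs) (simp add: algebra_simps)
  qed
  moreover have "invariant_metric metric"
    by (rule q.invariant_metric_deformation[OF deformation])
  ultimately show ?thesis using c by blast
qed

end
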